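(* Let $(S,E)$ be a Weyl $*$-semigroup. The Weyl groupoid $\mathcal{U}(S)$, i.e. the set of ultrafilters in $S$ considered as a topological subgroupoid of the coset groupoid $\mathcal{C}(S)$, is étale.
   Context: A $*$-semigroup is a semigroup $S$ with a unary operation $a\mapsto a^*$ satisfying $a^{**}=a$ and $(ab)^*=b^*a^*$. For $T,U\subseteq S$: $TU=\{tu:t\in T,u\in U\}$, $T^*=\{t^*:t\in T\}$. A Weyl $*$-semigroup $(S,E)$ is a $*$-semigroup $S$ with a subset $E$ such that $EE\subseteq E=E^*$, $a^*Ea\subseteq E$ for all $a\in S$, and for every $a\in S$ the element $a^*a$ lies in $E$ and commutes with every element of $E$. For $a,b\in S$: $a\precsim b$ iff $ab^*\in E$ and $a=ab^*b$. For $T\subseteq S$, $T^{\precsim}=\{a\in S:\exists t\in T\ (t\precsim a)\}$. A coset is a subset $C\subseteq S$ with $CC^*C\subseteq C=C^{\precsim}$. The set $\mathcal{C}(S)$ of non-empty cosets is a groupoid with inverse $C\mapsto C^*$ and product $(B,C)\mapsto(BC)^{\precsim}$, defined when $(B^*B)^{\precsim}=(CC^* )^{\precsim}$; its topology has as subbasis the sets $\{C\in\mathcal{C}(S):a\in C\}$, $a\in S$. A filter is a non-empty $U\subseteq S$ such that for all $a,b\in S$: $a,b\in U$ iff there is $c\in U$ with $c\precsim a$ and $c\precsim b$. An ultrafilter is a filter $U\neq S$ maximal with respect to inclusion among filters different from $S$. Ultrafilters are non-empty cosets. $\mathcal{U}(S)$ carries the restricted groupoid operations and the subspace topology, i.e.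 the topology generated by $\mathcal{U}_a=\{U\in\mathcal{U}(S):a\in U\}$, $a\in S$. A topological groupoid (one with continuous inverse and product) is étale if the product is an open map and the set of units is open; equivalently, the source map, regarded as a map from the groupoid to itself, is open (and hence a local homeomorphism). *)

theory Defs
  imports "HOL-Analysis.Analysis"
begin

text \<open>
  Groupoids in the algebraic (Hahn/Renault) style: a set of arrows, a set of composable pairs, a
  product that is only meaningful on composable pairs, and an inverse.  The unit space is
  recovered as the set of all products of an inverse \<open>g\<^sup>-\<^sup>1\<close> with \<open>g\<close>.
\<close>

record 'g groupoid_data =
  arrows :: "'g set"
  composable :: "('g \<times> 'g) set"
  gcomp :: "'g \<Rightarrow> 'g \<Rightarrow> 'g"
  ginv :: "'g \<Rightarrow> 'g"

definition groupoid :: "'g groupoid_data \<Rightarrow> bool" where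
  "groupoid G \<longleftrightarrow>
     composable G \<subseteq> arrows G \<times> arrows G \<and>
     (\<forall>(g, h) \<in> composable G. gcomp G g h \<in> arrows G) \<and>
     (\<forall>g \<in> arrows G. ginv G g \<in> arrows G \<and> ginv G (ginv G g) = g) \<and>
     (\<forall>g h k. (g, h) \<in> composable G \<and> (h, k) \<in> composable G \<longrightarrow>
        (gcomp G g h, k) \<in> composable G \<and> (g, gcomp G h k) \<in> composable G \<and>
        gcomp G (gcomp G g h) k = gcomp G g (gcomp G h k)) \<and>
     (\<forall>g \<in> arrows G. (ginv G g, g) \<in> composable G \<and> (g, ginv G g) \<in> composable G) \<and>
     (\<forall>(g, h) \<in> composable G.
        gcomp G (ginv G g) (gcomp G g h) = h \<and> gcomp G (gcomp G g h) (ginv G h) = g)"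

definition units :: "'g groupoid_data \<Rightarrow> 'g set" where
  "units G = {gcomp G (ginv G g) g | g. g \<in> arrows G}"

definition subgroupoid :: "'g set \<Rightarrow> 'g groupoid_data \<Rightarrow> bool" where
  "subgroupoid H G \<longleftrightarrow>
     groupoid G \<and> H \<subseteq> arrows G \<and>
     (\<forall>g \<in> H. ginv G g \<in> H) \<and>
     (\<forall>g \<in> H. \<forall>h \<in> H. (g, h) \<in> composable G \<longrightarrow> gcomp G g h \<in> H)"

definition restrict_groupoid :: "'g groupoid_data \<Rightarrow> 'g set \<Rightarrow> 'g groupoid_data" where
  "restrict_groupoid G H =
     \<lparr>arrows = arrows G \<inter> H, composable = composable G \<inter> H \<times> H, gcomp = gcomp G, ginv = ginv G\<rparr>"

definition composable_topology :: "'g groupoid_data \<Rightarrow> 'g topology \<Rightarrow> ('g \<times> 'g) topology" where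
  "composable_topology G T = subtopology (prod_topology T T) (composable G)"

definition topological_groupoid :: "'g groupoid_data \<Rightarrow> 'g topology \<Rightarrow> bool" where
  "topological_groupoid G T \<longleftrightarrow>
     groupoid G \<and> topspace T = arrows G \<and>
     continuous_map T T (ginv G) \<and>
     continuous_map (composable_topology G T) T (\<lambda>(g, h). gcomp G g h)"

definition etale_groupoid :: "'g groupoid_data \<Rightarrow> 'g topology \<Rightarrow> bool" where
  "etale_groupoid G T \<longleftrightarrow>
     topological_groupoid G T \<and>
     open_map (composable_topology G T) T (\<lambda>(g, h). gcomp G g h) \<and>
     openin T (units G)"


text \<open>The carrier \<open>S\<close> is an explicit set, which may be empty.\<close>

locale star_semigroup =
  fixes S :: "'a set"
    and mult :: "'a \<Rightarrow> 'a \<Rightarrow> 'a" (infixl "\<cdot>" 70)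
    and star :: "'a \<Rightarrow> 'a" ("_\<^sup>\<star>" [1000] 999)
  assumes mult_closed: "a \<in> S \<Longrightarrow> b \<in> S \<Longrightarrow> a \<cdot> b \<in> S"
    and star_closed: "a \<in> S \<Longrightarrow> a\<^sup>\<star> \<in> S"
    and mult_assoc: "a \<in> S \<Longrightarrow> b \<in> S \<Longrightarrow> c \<in> S \<Longrightarrow> (a \<cdot> b) \<cdot> c = a \<cdot> (b \<cdot> c)"
    and star_star: "a \<in> S \<Longrightarrow> (a\<^sup>\<star>)\<^sup>\<star> = a"
    and star_mult: "a \<in> S \<Longrightarrow> b \<in> S \<Longrightarrow> (a \<cdot> b)\<^sup>\<star> = b\<^sup>\<star> \<cdot> a\<^sup>\<star>"
begin

definition set_mult :: "'a set \<Rightarrow> 'a set \<Rightarrow> 'a set" (infixl "\<odot>" 70) where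
  "T \<odot> U = {t \<cdot> u | t u. t \<in> T \<and> u \<in> U}"

definition set_star :: "'a set \<Rightarrow> 'a set" ("_\<^sup>\<circledast>" [1000] 999) where
  "T\<^sup>\<circledast> = {t\<^sup>\<star> | t. t \<in> T}"

end

locale weyl_star_semigroup = star_semigroup +
  fixes E :: "'a set"
  assumes E_subset: "E \<subseteq> S"
    and E_mult: "E \<odot> E \<subseteq> E"
    and E_star: "E = E\<^sup>\<circledast>"
    and E_conj: "a \<in> S \<Longrightarrow> {a\<^sup>\<star>} \<odot> E \<odot> {a} \<subseteq> E"
    and star_mult_self: "a \<in> S \<Longrightarrow> a\<^sup>\<star> \<cdot> a \<in> E"
    and star_mult_self_commute: "a \<in> S \<Longrightarrow> e \<in> E \<Longrightarrow> (a\<^sup>\<star> \<cdot> a) \<cdot> e = e \<cdot> (a\<^sup>\<star> \<cdot> a)"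
begin

text \<open>This relation is transitive, but not reflexive in general.\<close>

definition below :: "'a \<Rightarrow> 'a \<Rightarrow> bool" (infix "\<lesssim>" 50) where
  "a \<lesssim> b \<longleftrightarrow> a \<cdot> b\<^sup>\<star> \<in> E \<and> a = a \<cdot> b\<^sup>\<star> \<cdot> b"

definition up :: "'a set \<Rightarrow> 'a set" where
  "up T = {a \<in> S. \<exists>t \<in> T. t \<lesssim> a}"

definition coset :: "'a set \<Rightarrow> bool" where
  "coset C \<longleftrightarrow> C \<subseteq> S \<and> C \<odot> C\<^sup>\<circledast> \<odot> C \<subseteq> C \<and> C = up C"

definition cosets :: "'a set set" where
  "cosets = {C. coset C \<and> C \<noteq> {}}"

definition coset_groupoid :: "'a set groupoid_data" where
  "coset_groupoid =
     \<lparr>arrows = cosets,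
      composable = {(B, C). B \<in> cosets \<and> C \<in> cosets \<and> up (B\<^sup>\<circledast> \<odot> B) = up (C \<odot> C\<^sup>\<circledast>)},
      gcomp = (\<lambda>B C. up (B \<odot> C)),
      ginv = set_star\<rparr>"

definition coset_topology :: "'a set topology" where
  "coset_topology = topology_generated_by {{C \<in> cosets. a \<in> C} | a. a \<in> S}"

definition filter_in :: "'a set \<Rightarrow> bool" where
  "filter_in U \<longleftrightarrow>
     U \<subseteq> S \<and> U \<noteq> {} \<and>
     (\<forall>a \<in> S. \<forall>b \<in> S. (a \<in> U \<and> b \<in> U) \<longleftrightarrow> (\<exists>c \<in> U. c \<lesssim> a \<and> c \<lesssim> b))"

definition ultrafilter_in :: "'a set \<Rightarrow> bool" where
  "ultrafilter_in U \<longleftrightarrow>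
     filter_in U \<and> U \<noteq> S \<and> (\<forall>V. filter_in V \<and> V \<noteq> S \<and> U \<subseteq> V \<longrightarrow> V = U)"

definition ultrafilters :: "'a set set" where
  "ultrafilters = {U. ultrafilter_in U}"

definition weyl_groupoid :: "'a set groupoid_data" where
  "weyl_groupoid = restrict_groupoid coset_groupoid ultrafilters"

definition weyl_topology :: "'a set topology" where
  "weyl_topology = subtopology coset_topology ultrafilters"

end

end

theory Submission
  imports Defs
begin

text \<open>
  Every element \<open>s\<close> acts partially on filters by right multiplication.  A filter \<open>F\<close> can be translated
  by \<open>s\<close> when some \<open>e \<in> F\<close> satisfies \<open>e s s\<^sup>\<star> = e\<close>; then \<open>F s\<close> generates a filter, to which \<open>s\<^sup>\<star>\<close> can be
  applied and from which it recovers \<open>F\<close> (lemma \<open>translate_translate\<close>).  Translation preserves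
  inclusions and the condition on \<open>e\<close> passes to larger filters, so translates of ultrafilters are
  ultrafilters.

  Everything else about ultrafilters rests on this.  If \<open>B\<close> and \<open>C\<close> are composable ultrafilters and
  \<open>c \<in> C\<close>, then \<open>B\<close> can be translated by \<open>c\<close>, and the translate lies in the filter generated by \<open>B C\<close>.
  By maximality the two agree, so \<open>B C\<close> generates an ultrafilter; hence the ultrafilters
  form a subgroupoid of the cosets.

  In the topology, the sets of ultrafilters containing a given \<open>a\<close> form a basis, since filters are
  downward directed.  Continuity of the product is immediate: an element of the product lies above
  some \<open>b c\<close>.  For openness, let \<open>b' \<lesssim> b\<close> in \<open>B\<close>
  and \<open>c' \<lesssim> c\<close> in \<open>C\<close>.  Any ultrafilter \<open>Q\<close> containing \<open>b' c'\<close> factors through \<open>b\<close> and \<open>c\<close>: the translate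
  of the range unit of \<open>Q\<close> by \<open>b\<close> is an ultrafilter \<open>B'\<close> with the range of \<open>Q\<close> that contains \<open>b\<close>, and
  \<open>B'\<^sup>-\<^sup>1 Q\<close> contains \<open>c\<close> because \<open>b\<^sup>\<star> b' c' \<lesssim> c\<close> (lemma \<open>factor_through\<close>).  Finally, an ultrafilter is a
  unit iff it meets \<open>E\<close> (lemma \<open>ultrafilter_unit_iff\<close>), so the units form a union of basic open sets.

  The groupoid laws for cosets are verified with sets instead of elements: for sets \<open>T \<subseteq> up T\<close> the
  upward closure can be taken before or after multiplying, and each law becomes an identity between
  products of sets.
\<close>

(* The symbol stands for the relation between elements below, not for comparison of cardinalities. *)
no_notation lepoll (infixl "\<lesssim>" 50)

section \<open>Subgroupoids\<close>

lemma groupoid_restrict_subgroupoid: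
  assumes "subgroupoid H G"
  shows "groupoid (restrict_groupoid G H)"
proof -
  let ?R = "restrict_groupoid G H"
  have G: "groupoid G" and H: "H \<subseteq> arrows G" "\<And>g. g \<in> H \<Longrightarrow> ginv G g \<in> H"
      "\<And>g h. g \<in> H \<Longrightarrow> h \<in> H \<Longrightarrow> (g, h) \<in> composable G \<Longrightarrow> gcomp G g h \<in> H"
    using assms unfolding subgroupoid_def by simp_all
  have arrows: "g \<in> H \<Longrightarrow> g \<in> arrows G" for g
    using H(1) by (rule subsetD)
  have R: "arrows ?R = H" "gcomp ?R = gcomp G" "ginv ?R = ginv G"
      "\<And>g h. (g, h) \<in> composable ?R \<longleftrightarrow> (g, h) \<in> composable G \<and> g \<in> H \<and> h \<in> H"
    unfolding restrict_groupoid_def using H(1) by auto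
  have "composable ?R \<subseteq> H \<times> H"
    by (auto simp: R(4))
  then show ?thesis
    using G unfolding groupoid_def[of G] unfolding groupoid_def[of ?R] R(1-3)
    by (auto simp: R(4) H(2,3) arrows)
qed

section \<open>Calculus of the relation\<close>

context weyl_star_semigroup
begin

lemmas carrier = mult_closed star_closed
lemmas normalize = mult_closed star_closed mult_assoc star_star star_mult

lemma E_carrier: "e \<in> E \<Longrightarrow> e \<in> S"
  using E_subset by blast

lemma E_mult_closed: "e \<in> E \<Longrightarrow> f \<in> E \<Longrightarrow> e \<cdot> f \<in> E"
  using E_mult unfolding set_mult_def by blast

lemma E_star_closed: "e \<in> E \<Longrightarrow> e\<^sup>\<star> \<in> E"
  using E_star unfolding set_star_def by blast

lemma E_conj_closed: "a \<in> S \<Longrightarrow> e \<in> E \<Longrightarrow> a\<^sup>\<star> \<cdot> e \<cdot> a \<in> E"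
  using E_conj[of a] unfolding set_mult_def by blast

lemma E_conj_closed': "a \<in> S \<Longrightarrow> e \<in> E \<Longrightarrow> a \<cdot> e \<cdot> a\<^sup>\<star> \<in> E"
  using E_conj_closed[of "a\<^sup>\<star>" e] by (simp add: star_closed star_star)

lemma mult_star_self: "a \<in> S \<Longrightarrow> a \<cdot> a\<^sup>\<star> \<in> E"
  using star_mult_self[of "a\<^sup>\<star>"] by (simp add: star_closed star_star)

lemma mult_star_self_commute: "a \<in> S \<Longrightarrow> e \<in> E \<Longrightarrow> (a \<cdot> a\<^sup>\<star>) \<cdot> e = e \<cdot> (a \<cdot> a\<^sup>\<star>)"
  using star_mult_self_commute[of "a\<^sup>\<star>"] by (simp add: star_closed star_star)

lemma belowI: "a \<cdot> b\<^sup>\<star> \<in> E \<Longrightarrow> a \<cdot> b\<^sup>\<star> \<cdot> b = a \<Longrightarrow> a \<lesssim> b"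
  unfolding below_def by simp

lemma below_E: "a \<lesssim> b \<Longrightarrow> a \<cdot> b\<^sup>\<star> \<in> E"
  unfolding below_def by simp

lemma below_eq: "a \<lesssim> b \<Longrightarrow> a \<cdot> b\<^sup>\<star> \<cdot> b = a"
  unfolding below_def by simp

lemma below_E_down: "a \<lesssim> e \<Longrightarrow> e \<in> E \<Longrightarrow> a \<in> E"
  using below_E below_eq E_mult_closed by metis

lemma below_trans:
  assumes "a \<in> S" "b \<in> S" "c \<in> S" "a \<lesssim> b" "b \<lesssim> c"
  shows "a \<lesssim> c"
proof (rule belowI)
  have "a \<cdot> c\<^sup>\<star> = (a \<cdot> b\<^sup>\<star> \<cdot> b) \<cdot> c\<^sup>\<star>"
    using below_eq[OF assms(4)] by simp
  then have eq: "a \<cdot> c\<^sup>\<star> = (a \<cdot> b\<^sup>\<star>) \<cdot> (b \<cdot> c\<^sup>\<star>)"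
    using assms(1-3) by (simp add: normalize)
  then show "a \<cdot> c\<^sup>\<star> \<in> E"
    using below_E assms(4,5) E_mult_closed by simp
  have "a \<cdot> c\<^sup>\<star> \<cdot> c = (a \<cdot> b\<^sup>\<star>) \<cdot> (b \<cdot> c\<^sup>\<star> \<cdot> c)"
    using eq assms(1-3) by (simp add: normalize)
  then show "a \<cdot> c\<^sup>\<star> \<cdot> c = a"
    using below_eq assms(4,5) by simp
qed

text \<open>
  The definition of the relation mentions right multiplication by \<open>b\<^sup>\<star> b\<close>. Since \<open>b b\<^sup>\<star>\<close>
  commutes with \<open>a b\<^sup>\<star> \<in> E\<close>, the same holds on the left, which makes the relation invariant under
  the involution.
\<close>

lemma below_left_eq:
  assumes "a \<in> S" "b \<in> S" "a \<lesssim> b"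
  shows "b \<cdot> b\<^sup>\<star> \<cdot> a = a"
proof -
  have "b \<cdot> b\<^sup>\<star> \<cdot> a = (b \<cdot> b\<^sup>\<star>) \<cdot> (a \<cdot> b\<^sup>\<star>) \<cdot> b"
    using below_eq[OF assms(3)] assms(1,2) by (simp add: normalize)
  also have "\<dots> = (a \<cdot> b\<^sup>\<star>) \<cdot> (b \<cdot> b\<^sup>\<star>) \<cdot> b"
    using mult_star_self_commute below_E[OF assms(3)] assms(2) by simp
  also have "\<dots> = (a \<cdot> b\<^sup>\<star> \<cdot> b) \<cdot> b\<^sup>\<star> \<cdot> b"
    using assms(1,2) by (simp add: normalize)
  also have "\<dots> = a"
    using below_eq[OF assms(3)] by simp
  finally show ?thesis .
qed

lemma below_left_E:
  assumes "a \<in> S" "b \<in> S" "a \<lesssim> b"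
  shows "a\<^sup>\<star> \<cdot> b \<in> E"
proof -
  have "a\<^sup>\<star> \<cdot> b = (a \<cdot> b\<^sup>\<star> \<cdot> b)\<^sup>\<star> \<cdot> b"
    using below_eq[OF assms(3)] by simp
  also have "\<dots> = b\<^sup>\<star> \<cdot> (a \<cdot> b\<^sup>\<star>)\<^sup>\<star> \<cdot> b"
    using assms(1,2) by (simp add: normalize)
  finally show ?thesis
    using E_conj_closed[OF assms(2)] E_star_closed[OF below_E[OF assms(3)]] by simp
qed

lemma below_star:
  assumes "a \<in> S" "b \<in> S" "a \<lesssim> b"
  shows "a\<^sup>\<star> \<lesssim> b\<^sup>\<star>"
proof (rule belowI)
  show "a\<^sup>\<star> \<cdot> (b\<^sup>\<star>)\<^sup>\<star> \<in> E"
    using below_left_E[OF assms] assms(2) by (simp add: star_star)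
  have "a\<^sup>\<star> = (b \<cdot> b\<^sup>\<star> \<cdot> a)\<^sup>\<star>"
    using below_left_eq[OF assms] by simp
  then show "a\<^sup>\<star> \<cdot> (b\<^sup>\<star>)\<^sup>\<star> \<cdot> b\<^sup>\<star> = a\<^sup>\<star>"
    using assms(1,2) by (simp add: normalize)
qed

lemma below_sandwich_E:
  assumes "a \<in> S" "b \<in> S" "a \<lesssim> b" "e \<in> E"
  shows "a \<cdot> e \<cdot> b\<^sup>\<star> \<in> E"
proof -
  have "a \<cdot> e \<cdot> b\<^sup>\<star> = (a \<cdot> b\<^sup>\<star> \<cdot> b) \<cdot> e \<cdot> b\<^sup>\<star>"
    using below_eq[OF assms(3)] by simp
  also have "\<dots> = (a \<cdot> b\<^sup>\<star>) \<cdot> (b \<cdot> e \<cdot> b\<^sup>\<star>)"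
    using assms E_carrier by (simp add: normalize)
  finally show ?thesis
    using E_mult_closed below_E[OF assms(3)] E_conj_closed'[OF assms(2,4)] by simp
qed

text \<open>
  Compatibility with products is where commutation is needed: the factors \<open>c d\<^sup>\<star> \<in> E\<close> and
  \<open>b\<^sup>\<star> b\<close> of \<open>(a c) (b d)\<^sup>\<star> (b d)\<close> must be exchanged.
\<close>

lemma below_mult:
  assumes "a \<in> S" "b \<in> S" "c \<in> S" "d \<in> S" "a \<lesssim> b" "c \<lesssim> d"
  shows "a \<cdot> c \<lesssim> b \<cdot> d"
proof (rule belowI)
  have "a \<cdot> (c \<cdot> d\<^sup>\<star>) \<cdot> b\<^sup>\<star> \<in> E"
    using below_sandwich_E assms(1,2,5) below_E[OF assms(6)] by simp
  then show "(a \<cdot> c) \<cdot> (b \<cdot> d)\<^sup>\<star> \<in> E"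
    using assms(1-4) by (simp add: normalize)
  have "(a \<cdot> c) \<cdot> (b \<cdot> d)\<^sup>\<star> \<cdot> (b \<cdot> d) = a \<cdot> ((c \<cdot> d\<^sup>\<star>) \<cdot> (b\<^sup>\<star> \<cdot> b)) \<cdot> d"
    using assms(1-4) by (simp add: normalize)
  also have "\<dots> = a \<cdot> ((b\<^sup>\<star> \<cdot> b) \<cdot> (c \<cdot> d\<^sup>\<star>)) \<cdot> d"
    using star_mult_self_commute[OF assms(2) below_E[OF assms(6)]] by simp
  also have "\<dots> = (a \<cdot> b\<^sup>\<star> \<cdot> b) \<cdot> (c \<cdot> d\<^sup>\<star> \<cdot> d)"
    using assms(1-4) by (simp add: normalize)
  finally show "(a \<cdot> c) \<cdot> (b \<cdot> d)\<^sup>\<star> \<cdot> (b \<cdot> d) = a \<cdot> c"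
    using below_eq assms(5,6) by simp
qed

text \<open>
  This is what makes filters cosets. One step down, to \<open>d\<close>, yields an element below \<open>a\<close>, \<open>b\<close> and
  \<open>c\<close>. The second step, to \<open>e\<close>, makes room for the factor \<open>d d\<^sup>\<star>\<close>, which can be moved next to
  \<open>b\<close> and turns it into the element \<open>d\<^sup>\<star> b\<close> of \<open>E\<close>.
\<close>

lemma below_triple:
  assumes S: "a \<in> S" "b \<in> S" "c \<in> S" "d \<in> S" "e \<in> S"
    and ed: "e \<lesssim> d" and da: "d \<lesssim> a" and db: "d \<lesssim> b" and dc: "d \<lesssim> c"
  shows "e \<lesssim> a \<cdot> b\<^sup>\<star> \<cdot> c"
proof (rule belowI)
  have ec: "e \<lesssim> c"
    using below_trans S ed dc by blast
  \<comment> \<open>The factor \<open>d d\<^sup>\<star>\<close> appears on the left of \<open>e\<close>; it commutes with \<open>e c\<^sup>\<star> \<in> E\<close>.\<close>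
  have "e \<cdot> c\<^sup>\<star> = (d \<cdot> d\<^sup>\<star>) \<cdot> (e \<cdot> c\<^sup>\<star>)"
    using below_left_eq[OF S(5,4) ed] S by (simp add: normalize flip: mult_assoc)
  also have "\<dots> = (e \<cdot> c\<^sup>\<star>) \<cdot> (d \<cdot> d\<^sup>\<star>)"
    using mult_star_self_commute[OF S(4) below_E[OF ec]] .
  finally have comm: "e \<cdot> c\<^sup>\<star> = (e \<cdot> c\<^sup>\<star>) \<cdot> (d \<cdot> d\<^sup>\<star>)" .
  have db': "d\<^sup>\<star> \<cdot> b \<in> E"
    using below_left_E S db by blast
  have "e \<cdot> (a \<cdot> b\<^sup>\<star> \<cdot> c)\<^sup>\<star> = (e \<cdot> c\<^sup>\<star>) \<cdot> b \<cdot> a\<^sup>\<star>"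
    using S by (simp add: normalize)
  also have "\<dots> = ((e \<cdot> c\<^sup>\<star>) \<cdot> (d \<cdot> d\<^sup>\<star>)) \<cdot> b \<cdot> a\<^sup>\<star>"
    using comm by simp
  also have "\<dots> = (e \<cdot> c\<^sup>\<star>) \<cdot> (d \<cdot> (d\<^sup>\<star> \<cdot> b) \<cdot> a\<^sup>\<star>)"
    using S by (simp add: normalize)
  finally have eq: "e \<cdot> (a \<cdot> b\<^sup>\<star> \<cdot> c)\<^sup>\<star> = (e \<cdot> c\<^sup>\<star>) \<cdot> (d \<cdot> (d\<^sup>\<star> \<cdot> b) \<cdot> a\<^sup>\<star>)" .
  then show "e \<cdot> (a \<cdot> b\<^sup>\<star> \<cdot> c)\<^sup>\<star> \<in> E"
    using E_mult_closed[OF below_E[OF ec] below_sandwich_E[OF S(4,1) da db']] by simp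
  have "e \<cdot> (a \<cdot> b\<^sup>\<star> \<cdot> c)\<^sup>\<star> \<cdot> (a \<cdot> b\<^sup>\<star> \<cdot> c)
      = (e \<cdot> c\<^sup>\<star>) \<cdot> d \<cdot> ((d\<^sup>\<star> \<cdot> b) \<cdot> (a\<^sup>\<star> \<cdot> a)) \<cdot> b\<^sup>\<star> \<cdot> c"
    unfolding eq using S by (simp add: normalize)
  also have "\<dots> = (e \<cdot> c\<^sup>\<star>) \<cdot> d \<cdot> ((a\<^sup>\<star> \<cdot> a) \<cdot> (d\<^sup>\<star> \<cdot> b)) \<cdot> b\<^sup>\<star> \<cdot> c"
    using star_mult_self_commute[OF S(1) db'] by simp
  also have "\<dots> = (e \<cdot> c\<^sup>\<star>) \<cdot> ((d \<cdot> a\<^sup>\<star> \<cdot> a) \<cdot> (b \<cdot> b\<^sup>\<star> \<cdot> d)\<^sup>\<star>) \<cdot> c"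
    using S by (simp add: normalize)
  also have "\<dots> = ((e \<cdot> c\<^sup>\<star>) \<cdot> (d \<cdot> d\<^sup>\<star>)) \<cdot> c"
    using below_eq[OF da] below_left_eq[OF S(4,2) db] by simp
  also have "\<dots> = e"
    using comm below_eq[OF ec] by simp
  finally show "e \<cdot> (a \<cdot> b\<^sup>\<star> \<cdot> c)\<^sup>\<star> \<cdot> (a \<cdot> b\<^sup>\<star> \<cdot> c) = e" .
qed

text \<open>
  The relation is not preserved by multiplication with a fixed \<open>s\<close>, as \<open>s \<lesssim> s\<close> may fail. It is
  preserved when \<open>s s\<^sup>\<star>\<close> acts as a right identity on the smaller element: then \<open>s\<close> cancels from
  \<open>(a s) (b s)\<^sup>\<star>\<close>. Translation of filters depends on this.
\<close>

lemma below_mult_right: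
  assumes S: "a \<in> S" "b \<in> S" "s \<in> S" and ab: "a \<lesssim> b" and as: "a \<cdot> s \<cdot> s\<^sup>\<star> = a"
  shows "a \<cdot> s \<lesssim> b \<cdot> s"
proof (rule belowI)
  have eq: "(a \<cdot> s) \<cdot> (b \<cdot> s)\<^sup>\<star> = a \<cdot> b\<^sup>\<star>"
    using S as by (simp add: star_mult carrier flip: mult_assoc)
  show "(a \<cdot> s) \<cdot> (b \<cdot> s)\<^sup>\<star> \<in> E"
    using eq below_E[OF ab] by simp
  show "(a \<cdot> s) \<cdot> (b \<cdot> s)\<^sup>\<star> \<cdot> (b \<cdot> s) = a \<cdot> s"
    unfolding eq using below_eq[OF ab] S by (simp add: carrier flip: mult_assoc)
qed

lemma below_fix_right:
  assumes S: "a \<in> S" "b \<in> S" "s \<in> S" and ab: "a \<lesssim> b" and bs: "b \<cdot> s \<cdot> s\<^sup>\<star> = b"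
  shows "a \<cdot> s \<cdot> s\<^sup>\<star> = a"
proof -
  have "a \<cdot> s \<cdot> s\<^sup>\<star> = (a \<cdot> b\<^sup>\<star> \<cdot> b) \<cdot> s \<cdot> s\<^sup>\<star>"
    using below_eq[OF ab] by simp
  also have "\<dots> = a \<cdot> b\<^sup>\<star> \<cdot> (b \<cdot> s \<cdot> s\<^sup>\<star>)"
    using S by (simp add: normalize)
  finally show ?thesis
    using bs below_eq[OF ab] by simp
qed

section \<open>The coset groupoid\<close>

lemma set_multI: "t \<in> T \<Longrightarrow> u \<in> U \<Longrightarrow> t \<cdot> u \<in> T \<odot> U"
  unfolding set_mult_def by blast

lemma set_multE:
  assumes "x \<in> T \<odot> U"
  obtains t u where "x = t \<cdot> u" "t \<in> T" "u \<in> U"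
  using assms unfolding set_mult_def by blast

lemma set_starI: "t \<in> T \<Longrightarrow> t\<^sup>\<star> \<in> T\<^sup>\<circledast>"
  unfolding set_star_def by blast

lemma set_mult_mono: "T \<subseteq> T' \<Longrightarrow> U \<subseteq> U' \<Longrightarrow> T \<odot> U \<subseteq> T' \<odot> U'"
  unfolding set_mult_def by blast

lemma set_mult_carrier: "T \<subseteq> S \<Longrightarrow> U \<subseteq> S \<Longrightarrow> T \<odot> U \<subseteq> S"
  unfolding set_mult_def using mult_closed by blast

lemma set_star_carrier: "T \<subseteq> S \<Longrightarrow> T\<^sup>\<circledast> \<subseteq> S"
  unfolding set_star_def using star_closed by blast

lemma set_mult_assoc:
  assumes "T \<subseteq> S" "U \<subseteq> S" "V \<subseteq> S"
  shows "(T \<odot> U) \<odot> V = T \<odot> (U \<odot> V)"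
proof (intro subset_antisym subsetI)
  fix x assume "x \<in> (T \<odot> U) \<odot> V"
  then obtain t u v where "x = (t \<cdot> u) \<cdot> v" "t \<in> T" "u \<in> U" "v \<in> V"
    by (elim set_multE) blast
  moreover from this have "x = t \<cdot> (u \<cdot> v)"
    using mult_assoc assms by blast
  ultimately show "x \<in> T \<odot> (U \<odot> V)"
    using set_multI by metis
next
  fix x assume "x \<in> T \<odot> (U \<odot> V)"
  then obtain t u v where x: "x = t \<cdot> (u \<cdot> v)" "t \<in> T" "u \<in> U" "v \<in> V"
    by (elim set_multE) blast
  moreover from this have "(t \<cdot> u) \<cdot> v = x"
    using mult_assoc assms by blast
  ultimately show "x \<in> (T \<odot> U) \<odot> V"
    using set_multI by metis
qed

lemma set_star_mult:
  assumes "T \<subseteq> S" "U \<subseteq> S"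
  shows "(T \<odot> U)\<^sup>\<circledast> = U\<^sup>\<circledast> \<odot> T\<^sup>\<circledast>"
proof -
  have eq: "(t \<cdot> u)\<^sup>\<star> = u\<^sup>\<star> \<cdot> t\<^sup>\<star>" if "t \<in> T" "u \<in> U" for t u
    using star_mult assms that by blast
  show ?thesis
  proof (intro subset_antisym subsetI)
    fix x assume "x \<in> (T \<odot> U)\<^sup>\<circledast>"
    then obtain t u where "x = (t \<cdot> u)\<^sup>\<star>" "t \<in> T" "u \<in> U"
      unfolding set_star_def set_mult_def by blast
    then show "x \<in> U\<^sup>\<circledast> \<odot> T\<^sup>\<circledast>"
      using eq by (simp add: set_multI set_starI)
  next
    fix x assume "x \<in> U\<^sup>\<circledast> \<odot> T\<^sup>\<circledast>"
    then obtain t u where x: "x = u\<^sup>\<star> \<cdot> t\<^sup>\<star>" "t \<in> T" "u \<in> U"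
      unfolding set_star_def set_mult_def by blast
    then have "x = (t \<cdot> u)\<^sup>\<star>"
      using eq by simp
    then show "x \<in> (T \<odot> U)\<^sup>\<circledast>"
      using x(2,3) by (simp add: set_multI set_starI)
  qed
qed

lemma mem_set_star_iff:
  assumes "T \<subseteq> S" "a \<in> S"
  shows "a \<in> T\<^sup>\<circledast> \<longleftrightarrow> a\<^sup>\<star> \<in> T"
proof
  assume "a \<in> T\<^sup>\<circledast>"
  then show "a\<^sup>\<star> \<in> T"
    using assms star_star unfolding set_star_def by auto
next
  assume "a\<^sup>\<star> \<in> T"
  then show "a \<in> T\<^sup>\<circledast>"
    using set_starI[of "a\<^sup>\<star>"] star_star[OF assms(2)] by simp
qed

lemma set_star_star:
  assumes "T \<subseteq> S"
  shows "(T\<^sup>\<circledast>)\<^sup>\<circledast> = T"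
proof -
  note T' = set_star_carrier[OF assms]
  have "x \<in> (T\<^sup>\<circledast>)\<^sup>\<circledast> \<longleftrightarrow> x \<in> T" if "x \<in> S" for x
    using mem_set_star_iff[OF T' that] mem_set_star_iff[OF assms star_closed[OF that]]
      star_star[OF that] by simp
  then show ?thesis
    using assms set_star_carrier[OF T'] by blast
qed

lemma upI: "t \<in> T \<Longrightarrow> t \<lesssim> a \<Longrightarrow> a \<in> S \<Longrightarrow> a \<in> up T"
  unfolding up_def by blast

lemma upE:
  assumes "a \<in> up T"
  obtains t where "t \<in> T" "t \<lesssim> a" "a \<in> S"
  using assms unfolding up_def by blast

lemma up_carrier: "up T \<subseteq> S"
  unfolding up_def by blast

lemma up_mono: "T \<subseteq> U \<Longrightarrow> up T \<subseteq> up U"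
  unfolding up_def by blast

lemma up_up: "T \<subseteq> S \<Longrightarrow> up (up T) \<subseteq> up T"
  unfolding up_def using below_trans by blast

lemma up_least: "T \<subseteq> up U \<Longrightarrow> U \<subseteq> S \<Longrightarrow> up T \<subseteq> up U"
  using up_mono up_up by blast

lemma up_mult: "T \<subseteq> S \<Longrightarrow> U \<subseteq> S \<Longrightarrow> up T \<odot> up U \<subseteq> up (T \<odot> U)"
  by (auto elim!: set_multE upE intro!: upI set_multI below_mult mult_closed)

lemma up_star: 
  assumes "T \<subseteq> S" shows "(up T)\<^sup>\<circledast> = up (T\<^sup>\<circledast>)"
proof -
  have *: "(up U)\<^sup>\<circledast> \<subseteq> up (U\<^sup>\<circledast>)" if "U \<subseteq> S" for U
    using that unfolding set_star_def up_def using below_star star_closed by blast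
  have "up (T\<^sup>\<circledast>) = ((up (T\<^sup>\<circledast>))\<^sup>\<circledast>)\<^sup>\<circledast>"
    using set_star_star up_carrier by simp
  also have "\<dots> \<subseteq> (up T)\<^sup>\<circledast>"
    using *[of "T\<^sup>\<circledast>"] assms set_star_carrier set_star_star unfolding set_star_def by auto
  finally show ?thesis using *[OF assms] by blast
qed

text \<open>
  The relation is not reflexive, so \<open>T \<subseteq> up T\<close> is a genuine condition. For such sets \<open>up\<close> is
  idempotent and may be inserted or removed anywhere inside a product whose upward closure is taken.
\<close>

definition rounded :: "'a set \<Rightarrow> bool" where
  "rounded T \<longleftrightarrow> T \<subseteq> S \<and> T \<subseteq> up T"

lemma rounded_carrier: "rounded T \<Longrightarrow> T \<subseteq> S"
  unfolding rounded_def by blast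

lemma rounded_subset_up: "rounded T \<Longrightarrow> T \<subseteq> up T"
  unfolding rounded_def by blast

lemma rounded_mult: "rounded T \<Longrightarrow> rounded U \<Longrightarrow> rounded (T \<odot> U)"
  unfolding rounded_def using set_mult_carrier set_mult_mono up_mult by (meson order_trans)

lemma rounded_star: "rounded T \<Longrightarrow> rounded (T\<^sup>\<circledast>)"
  unfolding rounded_def using up_star set_star_carrier unfolding set_star_def by blast

lemma rounded_up: "rounded T \<Longrightarrow> rounded (up T)"
  unfolding rounded_def using up_carrier up_mono by blast

lemma up_up_eq: "rounded T \<Longrightarrow> up (up T) = up T"
  unfolding rounded_def using up_up up_mono by blast

lemma up_mult_up_left:
  assumes "rounded T" "rounded U"
  shows "up (up T \<odot> U) = up (T \<odot> U)"
proof
  have "up T \<odot> U \<subseteq> up (T \<odot> U)"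
    using up_mult[of T U] set_mult_mono[of "up T" "up T" U "up U"] assms
    unfolding rounded_def by blast
  then show "up (up T \<odot> U) \<subseteq> up (T \<odot> U)"
    using up_least set_mult_carrier assms rounded_carrier by simp
  show "up (T \<odot> U) \<subseteq> up (up T \<odot> U)"
    using assms rounded_subset_up by (simp add: up_mono set_mult_mono)
qed

lemma up_mult_up_right:
  assumes "rounded T" "rounded U"
  shows "up (T \<odot> up U) = up (T \<odot> U)"
proof
  have "T \<odot> up U \<subseteq> up (T \<odot> U)"
    using up_mult[of T U] set_mult_mono[of T "up T" "up U" "up U"] assms
    unfolding rounded_def by blast
  then show "up (T \<odot> up U) \<subseteq> up (T \<odot> U)"
    using up_least set_mult_carrier assms rounded_carrier by simp
  show "up (T \<odot> U) \<subseteq> up (T \<odot> up U)"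
    using assms rounded_subset_up by (simp add: up_mono set_mult_mono)
qed

lemma coset_rounded: "coset C \<Longrightarrow> rounded C"
  unfolding coset_def rounded_def by blast

lemma coset_carrier: "coset C \<Longrightarrow> C \<subseteq> S"
  unfolding coset_def by blast

lemma coset_up: "coset C \<Longrightarrow> up C = C"
  unfolding coset_def by blast

lemma coset_triple:
  assumes "coset C" "a \<in> C" "b \<in> C" "c \<in> C"
  shows "a \<cdot> b\<^sup>\<star> \<cdot> c \<in> C"
proof -
  have "a \<cdot> b\<^sup>\<star> \<cdot> c \<in> C \<odot> C\<^sup>\<circledast> \<odot> C"
    using assms(2-4) by (intro set_multI set_starI)
  then show ?thesis
    using assms(1) unfolding coset_def by blast
qed

text \<open>
  If \<open>t \<lesssim> c\<close> in \<open>C\<close>, then \<open>t = t c\<^sup>\<star> c\<close> is itself a triple product and lies below \<open>c\<close>.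
\<close>

lemma up_triple_coset:
  assumes "coset C"
  shows "up (C \<odot> C\<^sup>\<circledast> \<odot> C) = C"
proof
  show "up (C \<odot> C\<^sup>\<circledast> \<odot> C) \<subseteq> C"
    using assms up_mono unfolding coset_def by blast
  show "C \<subseteq> up (C \<odot> C\<^sup>\<circledast> \<odot> C)"
  proof
    fix c assume c: "c \<in> C"
    then obtain t where t: "t \<in> C" "t \<lesssim> c"
      using assms unfolding coset_def up_def by blast
    have "t \<cdot> c\<^sup>\<star> \<cdot> c \<in> C \<odot> C\<^sup>\<circledast> \<odot> C"
      using c t by (simp add: set_multI set_starI)
    then show "c \<in> up (C \<odot> C\<^sup>\<circledast> \<odot> C)"
      using below_eq[OF t(2)] t(2) c assms coset_carrier upI by fastforce
  qed
qed

lemma coset_star: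
  assumes "coset C"
  shows "coset (C\<^sup>\<circledast>)"
proof -
  note C = coset_carrier[OF assms]
  have "C\<^sup>\<circledast> \<odot> (C\<^sup>\<circledast>)\<^sup>\<circledast> \<odot> C\<^sup>\<circledast> = (C \<odot> C\<^sup>\<circledast> \<odot> C)\<^sup>\<circledast>"
    using C by (simp add: set_star_mult set_mult_carrier set_star_carrier set_star_star set_mult_assoc)
  also have "\<dots> \<subseteq> C\<^sup>\<circledast>"
    using assms unfolding coset_def set_star_def by blast
  finally show ?thesis
    using C up_star[OF C] coset_up[OF assms] set_star_carrier unfolding coset_def by simp
qed

lemma coset_of_rounded:
  assumes "rounded P" "P \<odot> P\<^sup>\<circledast> \<odot> P \<subseteq> up P"
  shows "coset (up P)"
proof -
  note P = rounded_carrier[OF assms(1)]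
  have "up P \<odot> (up P)\<^sup>\<circledast> \<odot> up P \<subseteq> up (P \<odot> P\<^sup>\<circledast>) \<odot> up P"
    using up_mult[of P "P\<^sup>\<circledast>"] P set_star_carrier by (simp add: up_star set_mult_mono)
  also have "\<dots> \<subseteq> up (P \<odot> P\<^sup>\<circledast> \<odot> P)"
    using up_mult P set_star_carrier set_mult_carrier by simp
  also have "\<dots> \<subseteq> up P"
    using assms(2) up_least P by simp
  finally show ?thesis
    unfolding coset_def using up_up_eq[OF assms(1)] up_carrier by simp
qed

definition source :: "'a set \<Rightarrow> 'a set" where
  "source C = up (C\<^sup>\<circledast> \<odot> C)"

definition range_of :: "'a set \<Rightarrow> 'a set" where
  "range_of C = up (C \<odot> C\<^sup>\<circledast>)"

lemma source_star: "coset C \<Longrightarrow> source (C\<^sup>\<circledast>) = range_of C"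
  unfolding source_def range_of_def by (simp add: set_star_star coset_carrier)

lemma range_star: "coset C \<Longrightarrow> range_of (C\<^sup>\<circledast>) = source C"
  unfolding source_def range_of_def by (simp add: set_star_star coset_carrier)

lemma up_range_mult:
  assumes "coset C"
  shows "up (range_of C \<odot> C) = C"
  unfolding range_of_def
  using up_mult_up_left[of "C \<odot> C\<^sup>\<circledast>" C] assms
  by (simp add: rounded_mult rounded_star coset_rounded up_triple_coset)

lemma up_mult_source:
  assumes "coset C"
  shows "up (C \<odot> source C) = C"
  unfolding source_def
  using up_mult_up_right[of C "C\<^sup>\<circledast> \<odot> C"] up_triple_coset[OF assms] assms
  by (simp add: rounded_mult rounded_star coset_rounded set_mult_assoc set_star_carrier coset_carrier)

lemma star_up_mult:
  assumes "coset B" "coset C"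
  shows "(up (B \<odot> C))\<^sup>\<circledast> = up (C\<^sup>\<circledast> \<odot> B\<^sup>\<circledast>)"
  using assms by (simp add: up_star set_star_mult set_mult_carrier coset_carrier)

lemma up_mult_assoc:
  assumes "rounded B" "rounded C" "rounded D"
  shows "up (up (B \<odot> C) \<odot> D) = up (B \<odot> up (C \<odot> D))"
  using assms
  by (simp add: up_mult_up_left up_mult_up_right rounded_mult set_mult_assoc rounded_carrier)

text \<open>
  In \<open>B C C\<^sup>\<star> B\<^sup>\<star> B C\<close> the middle factors \<open>C C\<^sup>\<star>\<close> and \<open>B\<^sup>\<star> B\<close> both generate the source of \<open>B\<close>, which
  \<open>B\<close> absorbs on the right.
\<close>

lemma coset_mult:
  assumes B: "coset B" and C: "coset C" and BC: "source B = range_of C"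
  shows "coset (up (B \<odot> C))"
proof (rule coset_of_rounded)
  note r = coset_rounded[OF B] coset_rounded[OF C]
    rounded_star[OF coset_rounded[OF B]] rounded_star[OF coset_rounded[OF C]]
  note c = r[THEN rounded_carrier]
  show "rounded (B \<odot> C)"
    using r by (simp add: rounded_mult)
  have rP: "rounded (B \<odot> (C \<odot> C\<^sup>\<circledast>) \<odot> (B\<^sup>\<circledast> \<odot> B) \<odot> C)"
    using r by (simp add: rounded_mult)
  have "(B \<odot> C) \<odot> (B \<odot> C)\<^sup>\<circledast> \<odot> (B \<odot> C) = B \<odot> (C \<odot> C\<^sup>\<circledast>) \<odot> (B\<^sup>\<circledast> \<odot> B) \<odot> C"
    using c by (simp add: set_star_mult set_mult_assoc set_mult_carrier)
  also have "\<dots> \<subseteq> up \<dots>"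
    using rounded_subset_up[OF rP] .
  also have "\<dots> = up (up (up (B \<odot> up (C \<odot> C\<^sup>\<circledast>)) \<odot> up (B\<^sup>\<circledast> \<odot> B)) \<odot> C)"
    using r by (simp add: up_mult_up_left up_mult_up_right rounded_mult rounded_up)
  also have "\<dots> = up (B \<odot> C)"
    using up_mult_source[OF B] BC unfolding source_def range_of_def by simp
  finally show "(B \<odot> C) \<odot> (B \<odot> C)\<^sup>\<circledast> \<odot> (B \<odot> C) \<subseteq> up (B \<odot> C)" .
qed

lemma source_mult:
  assumes B: "coset B" and C: "coset C" and BC: "source B = range_of C"
  shows "source (up (B \<odot> C)) = source C"
proof -
  note r = coset_rounded[OF B] coset_rounded[OF C]
    rounded_star[OF coset_rounded[OF B]] rounded_star[OF coset_rounded[OF C]]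
  note c = r[THEN rounded_carrier]
  have "source (up (B \<odot> C)) = up (C\<^sup>\<circledast> \<odot> B\<^sup>\<circledast> \<odot> (B \<odot> C))"
    unfolding source_def star_up_mult[OF B C]
    using r by (simp add: up_mult_up_left up_mult_up_right rounded_mult rounded_up)
  also have "\<dots> = up (C\<^sup>\<circledast> \<odot> ((B\<^sup>\<circledast> \<odot> B) \<odot> C))"
    using c by (simp add: set_mult_assoc set_mult_carrier)
  also have "\<dots> = up (C\<^sup>\<circledast> \<odot> up (source B \<odot> C))"
    unfolding source_def using r by (simp add: up_mult_up_left up_mult_up_right rounded_mult)
  also have "\<dots> = source C"
    unfolding BC up_range_mult[OF C] unfolding source_def ..
  finally show ?thesis .
qed

lemma range_mult:
  assumes B: "coset B" and C: "coset C" and BC: "source B = range_of C"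
  shows "range_of (up (B \<odot> C)) = range_of B"
proof -
  have "source (up (C\<^sup>\<circledast> \<odot> B\<^sup>\<circledast>)) = source (B\<^sup>\<circledast>)"
    using assms by (intro source_mult) (simp_all add: coset_star source_star range_star)
  then show ?thesis
    using assms source_star[OF coset_mult[OF assms]] source_star[OF B] star_up_mult[OF B C] by simp
qed

lemma up_inverse_mult:
  assumes B: "coset B" and C: "coset C" and BC: "source B = range_of C"
  shows "up (B\<^sup>\<circledast> \<odot> up (B \<odot> C)) = C"
proof -
  have "up (B\<^sup>\<circledast> \<odot> up (B \<odot> C)) = up (source B \<odot> C)"
    unfolding source_def
    using B C by (simp add: up_mult_assoc[symmetric] coset_rounded rounded_star)
  then show ?thesis
    using BC up_range_mult[OF C] by simp
qed

lemma up_mult_inverse: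
  assumes B: "coset B" and C: "coset C" and BC: "source B = range_of C"
  shows "up (up (B \<odot> C) \<odot> C\<^sup>\<circledast>) = B"
proof -
  have "up (up (B \<odot> C) \<odot> C\<^sup>\<circledast>) = up (B \<odot> range_of C)"
    unfolding range_of_def
    using B C by (simp add: up_mult_assoc coset_rounded rounded_star)
  then show ?thesis
    using BC[symmetric] up_mult_source[OF B] by simp
qed

lemma composable_coset_groupoid:
  "(B, C) \<in> composable coset_groupoid \<longleftrightarrow> B \<in> cosets \<and> C \<in> cosets \<and> source B = range_of C"
  unfolding coset_groupoid_def source_def range_of_def by simp

lemma coset_groupoid_simps [simp]:
  "arrows coset_groupoid = cosets"
  "gcomp coset_groupoid = (\<lambda>B C. up (B \<odot> C))"
  "ginv coset_groupoid = set_star"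
  unfolding coset_groupoid_def by simp_all

lemma mem_cosets: "C \<in> cosets \<longleftrightarrow> coset C \<and> C \<noteq> {}"
  unfolding cosets_def by simp

lemma star_nonempty: "C \<noteq> {} \<Longrightarrow> C\<^sup>\<circledast> \<noteq> {}"
  unfolding set_star_def by blast

lemma up_mult_nonempty:
  assumes "rounded B" "rounded C" "B \<noteq> {}" "C \<noteq> {}"
  shows "up (B \<odot> C) \<noteq> {}"
  using rounded_subset_up[OF rounded_mult[OF assms(1,2)]] assms(3,4) set_multI by blast

text \<open>
  The laws are those of an ordinary groupoid calculus with \<open>source\<close> and \<open>range_of\<close>: composability
  means that source and range agree, products inherit the outer source and range, and each coset
  absorbs its source on the right and its range on the left.
\<close>

lemma groupoid_coset_groupoid: "groupoid coset_groupoid"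
  unfolding groupoid_def
proof (intro conjI)
  show "composable coset_groupoid \<subseteq> arrows coset_groupoid \<times> arrows coset_groupoid"
    unfolding coset_groupoid_def by auto
  show "\<forall>(g, h)\<in>composable coset_groupoid. gcomp coset_groupoid g h \<in> arrows coset_groupoid"
    by (auto simp: composable_coset_groupoid mem_cosets coset_mult up_mult_nonempty coset_rounded)
  show "\<forall>g\<in>arrows coset_groupoid. ginv coset_groupoid g \<in> arrows coset_groupoid
      \<and> ginv coset_groupoid (ginv coset_groupoid g) = g"
    by (auto simp: mem_cosets coset_star star_nonempty set_star_star coset_carrier)
  show "\<forall>g h k. (g, h) \<in> composable coset_groupoid \<and> (h, k) \<in> composable coset_groupoid \<longrightarrow>
        (gcomp coset_groupoid g h, k) \<in> composable coset_groupoid \<and>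
        (g, gcomp coset_groupoid h k) \<in> composable coset_groupoid \<and>
        gcomp coset_groupoid (gcomp coset_groupoid g h) k
          = gcomp coset_groupoid g (gcomp coset_groupoid h k)"
    by (auto simp: composable_coset_groupoid mem_cosets coset_mult up_mult_nonempty coset_rounded
        source_mult range_mult up_mult_assoc)
  show "\<forall>g\<in>arrows coset_groupoid. (ginv coset_groupoid g, g) \<in> composable coset_groupoid
      \<and> (g, ginv coset_groupoid g) \<in> composable coset_groupoid"
    by (auto simp: composable_coset_groupoid mem_cosets coset_star star_nonempty source_star range_star)
  show "\<forall>(g, h)\<in>composable coset_groupoid.
      gcomp coset_groupoid (ginv coset_groupoid g) (gcomp coset_groupoid g h) = h \<and>
      gcomp coset_groupoid (gcomp coset_groupoid g h) (ginv coset_groupoid h) = g"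
    by (auto simp: composable_coset_groupoid mem_cosets up_inverse_mult up_mult_inverse)
qed

section \<open>Filters and their translates\<close>

lemma filter_carrier: "filter_in F \<Longrightarrow> F \<subseteq> S"
  unfolding filter_in_def by blast

lemma filter_mem_carrier: "filter_in F \<Longrightarrow> a \<in> F \<Longrightarrow> a \<in> S"
  unfolding filter_in_def by blast

lemma filter_nonempty: "filter_in F \<Longrightarrow> F \<noteq> {}"
  unfolding filter_in_def by blast

lemma filter_directed:
  assumes "filter_in F" "a \<in> F" "b \<in> F"
  obtains c where "c \<in> F" "c \<lesssim> a" "c \<lesssim> b"
  using assms unfolding filter_in_def by blast

lemma filter_upward: "filter_in F \<Longrightarrow> a \<in> F \<Longrightarrow> a \<lesssim> b \<Longrightarrow> b \<in> S \<Longrightarrow> b \<in> F"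
  unfolding filter_in_def by blast

lemma filter_up: "filter_in F \<Longrightarrow> up F = F"
  unfolding filter_in_def up_def by blast

lemma filter_rounded: "filter_in F \<Longrightarrow> rounded F"
  unfolding rounded_def using filter_carrier filter_up by simp

lemma filter_coset:
  assumes "filter_in F"
  shows "coset F"
proof -
  have "x \<in> F" if mem: "x \<in> F \<odot> F\<^sup>\<circledast> \<odot> F" for x
  proof -
    obtain a b c where x: "x = a \<cdot> b\<^sup>\<star> \<cdot> c" and abc: "a \<in> F" "b \<in> F" "c \<in> F"
      using mem unfolding set_mult_def set_star_def by blast
    obtain d1 where d1: "d1 \<in> F" "d1 \<lesssim> a" "d1 \<lesssim> b"
      using filter_directed assms abc by metis
    obtain d where d: "d \<in> F" "d \<lesssim> d1" "d \<lesssim> c"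
      using filter_directed assms abc d1 by metis
    obtain e where e: "e \<in> F" "e \<lesssim> d"
      using filter_directed assms d by metis
    note S = abc[THEN filter_mem_carrier[OF assms]] d(1)[THEN filter_mem_carrier[OF assms]]
      e(1)[THEN filter_mem_carrier[OF assms]] d1(1)[THEN filter_mem_carrier[OF assms]]
    have "d \<lesssim> a" "d \<lesssim> b"
      using below_trans S d d1 by blast+
    then have "e \<lesssim> a \<cdot> b\<^sup>\<star> \<cdot> c"
      using below_triple S d e by blast
    then show ?thesis
      using filter_upward[OF assms e(1)] x S by (simp add: carrier)
  qed
  then show ?thesis
    unfolding coset_def using filter_carrier filter_up assms by auto
qed

lemma filter_of_directed:
  assumes "T \<subseteq> S" "T \<noteq> {}" "\<And>a b. a \<in> T \<Longrightarrow> b \<in> T \<Longrightarrow> \<exists>c\<in>T. c \<lesssim> a \<and> c \<lesssim> b"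
  shows "filter_in (up T)"
proof -
  have r: "T \<subseteq> up T"
    using assms(1,3) upI by blast
  have "\<exists>d\<in>up T. d \<lesssim> a \<and> d \<lesssim> b" if "a \<in> up T" "b \<in> up T" "a \<in> S" "b \<in> S" for a b
  proof -
    obtain t u where tu: "t \<in> T" "t \<lesssim> a" "u \<in> T" "u \<lesssim> b"
      using \<open>a \<in> up T\<close> \<open>b \<in> up T\<close> by (elim upE)
    obtain c where c: "c \<in> T" "c \<lesssim> t" "c \<lesssim> u"
      using assms(3) tu by blast
    have "c \<lesssim> a" "c \<lesssim> b"
      using below_trans[of c t a] below_trans[of c u b] c tu assms(1) that(3,4) by auto
    then show ?thesis
      using c r by blast
  qed
  moreover have "a \<in> up T" if "d \<in> up T" "d \<lesssim> a" "a \<in> S" for a d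
    using that up_up[OF assms(1)] upI by blast
  ultimately show ?thesis
    unfolding filter_in_def using r assms(2) up_carrier by blast
qed

lemma filter_star:
  assumes "filter_in F"
  shows "filter_in (F\<^sup>\<circledast>)"
proof -
  have "filter_in (up (F\<^sup>\<circledast>))"
  proof (rule filter_of_directed)
    fix a b assume "a \<in> F\<^sup>\<circledast>" "b \<in> F\<^sup>\<circledast>"
    then obtain x y where xy: "a = x\<^sup>\<star>" "b = y\<^sup>\<star>" "x \<in> F" "y \<in> F"
      unfolding set_star_def by blast
    obtain c where "c \<in> F" "c \<lesssim> x" "c \<lesssim> y"
      using filter_directed assms xy(3,4) by metis
    then show "\<exists>c\<in>F\<^sup>\<circledast>. c \<lesssim> a \<and> c \<lesssim> b"
      using xy below_star filter_mem_carrier[OF assms] set_starI by metis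
  qed (use assms in \<open>simp_all add: set_star_carrier filter_carrier filter_nonempty star_nonempty\<close>)
  then show ?thesis
    using up_star[OF filter_carrier] filter_up assms by metis
qed

lemma filter_mult:
  assumes "filter_in F" "filter_in G"
  shows "filter_in (up (F \<odot> G))"
proof (rule filter_of_directed)
  fix x y assume "x \<in> F \<odot> G" "y \<in> F \<odot> G"
  then obtain a b c d where xy: "x = a \<cdot> b" "y = c \<cdot> d" "a \<in> F" "b \<in> G" "c \<in> F" "d \<in> G"
    by (elim set_multE) blast
  obtain f where f: "f \<in> F" "f \<lesssim> a" "f \<lesssim> c"
    using filter_directed assms xy by metis
  obtain g where g: "g \<in> G" "g \<lesssim> b" "g \<lesssim> d"
    using filter_directed assms xy by metis
  have "f \<cdot> g \<lesssim> x" "f \<cdot> g \<lesssim> y"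
    using below_mult f g xy assms filter_mem_carrier by simp_all
  then show "\<exists>z\<in>F \<odot> G. z \<lesssim> x \<and> z \<lesssim> y"
    using set_multI f g by blast
next
  show "F \<odot> G \<noteq> {}"
    using assms[THEN filter_nonempty] set_multI by blast
qed (use assms in \<open>simp add: set_mult_carrier filter_carrier\<close>)

text \<open>
  Heuristically, the source of \<open>F\<close> lies in the domain of the partial action of \<open>s\<close>. Once one \<open>e\<close> has
  this property, all elements below \<open>e\<close> have it, hence a coinitial part of \<open>F\<close>.
\<close>

definition translatable :: "'a set \<Rightarrow> 'a \<Rightarrow> bool" where
  "translatable F s \<longleftrightarrow> filter_in F \<and> s \<in> S \<and> (\<exists>e\<in>F. e \<cdot> s \<cdot> s\<^sup>\<star> = e)"

lemma translatable_mono: "translatable F s \<Longrightarrow> F \<subseteq> G \<Longrightarrow> filter_in G \<Longrightarrow> translatable G s"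
  unfolding translatable_def by blast

lemma translatable_directed:
  assumes "translatable F s" "a \<in> F" "b \<in> F"
  obtains c where "c \<in> F" "c \<lesssim> a" "c \<lesssim> b" "c \<cdot> s \<cdot> s\<^sup>\<star> = c"
proof -
  obtain e where e: "e \<in> F" "e \<cdot> s \<cdot> s\<^sup>\<star> = e" and F: "filter_in F" and s: "s \<in> S"
    using assms(1) unfolding translatable_def by blast
  obtain d where d: "d \<in> F" "d \<lesssim> a" "d \<lesssim> e"
    using filter_directed F assms e by metis
  obtain c where c: "c \<in> F" "c \<lesssim> d" "c \<lesssim> b"
    using filter_directed F assms d by metis
  have S: "a \<in> S" "c \<in> S" "d \<in> S" "e \<in> S"
    using filter_mem_carrier F c d e assms by auto
  have "c \<lesssim> a" "c \<lesssim> e"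
    using below_trans S c d by blast+
  then show thesis
    using that c below_fix_right S s e by blast
qed

definition translate :: "'a set \<Rightarrow> 'a \<Rightarrow> 'a set" where
  "translate F s = up (F \<odot> {s})"

lemma translate_mono: "F \<subseteq> G \<Longrightarrow> translate F s \<subseteq> translate G s"
  unfolding translate_def by (simp add: up_mono set_mult_mono)

lemma filter_translate:
  assumes "translatable F s"
  shows "filter_in (translate F s)"
  unfolding translate_def
proof (rule filter_of_directed)
  have F: "filter_in F" and s: "s \<in> S"
    using assms unfolding translatable_def by blast+
  show "F \<odot> {s} \<subseteq> S"
    using F s by (simp add: set_mult_carrier filter_carrier)
  show "F \<odot> {s} \<noteq> {}"
    using filter_nonempty[OF F] set_multI by blast
  fix x y assume "x \<in> F \<odot> {s}" "y \<in> F \<odot> {s}"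
  then obtain a b where xy: "x = a \<cdot> s" "y = b \<cdot> s" "a \<in> F" "b \<in> F"
    by (auto elim!: set_multE)
  obtain c where "c \<in> F" "c \<lesssim> a" "c \<lesssim> b" "c \<cdot> s \<cdot> s\<^sup>\<star> = c"
    using translatable_directed assms xy by metis
  then show "\<exists>z\<in>F \<odot> {s}. z \<lesssim> x \<and> z \<lesssim> y"
    using below_mult_right xy filter_mem_carrier[OF F] s set_multI by (metis singletonI)
qed

lemma translate_memI:
  assumes "translatable F s" "a \<in> F" "a \<cdot> s \<cdot> s\<^sup>\<star> = a"
  shows "a \<cdot> s \<in> translate F s"
proof -
  have F: "filter_in F" and s: "s \<in> S"
    using assms unfolding translatable_def by blast+
  obtain c where c: "c \<in> F" "c \<lesssim> a" "c \<cdot> s \<cdot> s\<^sup>\<star> = c"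
    using translatable_directed assms by metis
  have "c \<cdot> s \<lesssim> a \<cdot> s"
    using below_mult_right c F s assms(2) filter_mem_carrier by blast
  then show ?thesis
    unfolding translate_def using c F s assms(2) filter_mem_carrier carrier
    by (intro upI[of "c \<cdot> s"] set_multI) auto
qed

lemma translatable_translate:
  assumes "translatable F s"
  shows "translatable (translate F s) (s\<^sup>\<star>)"
proof -
  have F: "filter_in F" and s: "s \<in> S"
    using assms unfolding translatable_def by blast+
  obtain e where e: "e \<in> F" "e \<cdot> s \<cdot> s\<^sup>\<star> = e"
    using assms unfolding translatable_def by blast
  have "e \<cdot> s \<cdot> s\<^sup>\<star> \<cdot> (s\<^sup>\<star>)\<^sup>\<star> = e \<cdot> s"
    using e s by (simp add: star_star)
  then show ?thesis
    unfolding translatable_def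
    using filter_translate translate_memI assms e s star_closed by blast
qed

text \<open>
  The delicate step is that \<open>c s \<lesssim> x\<close> implies \<open>c = c s s\<^sup>\<star> \<lesssim> x s\<^sup>\<star>\<close> for small \<open>c \<in> F\<close>. It is
  \<open>below_mult_right\<close> for \<open>s\<^sup>\<star>\<close>, as \<open>s\<^sup>\<star> s\<close> acts as a right identity on \<open>c s\<close>.
\<close>

lemma translate_translate:
  assumes "translatable F s"
  shows "translate (translate F s) (s\<^sup>\<star>) = F"
proof
  have F: "filter_in F" and s: "s \<in> S"
    using assms unfolding translatable_def by blast+
  note t = filter_translate[OF assms]
  show "F \<subseteq> translate (translate F s) (s\<^sup>\<star>)"
  proof
    fix f assume f: "f \<in> F"
    obtain c where c: "c \<in> F" "c \<lesssim> f" "c \<cdot> s \<cdot> s\<^sup>\<star> = c"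
      using translatable_directed assms f by metis
    have "c \<cdot> s \<cdot> s\<^sup>\<star> \<in> translate F s \<odot> {s\<^sup>\<star>}"
      using translate_memI[OF assms c(1,3)] set_multI by blast
    then show "f \<in> translate (translate F s) (s\<^sup>\<star>)"
      unfolding translate_def[of "translate F s"]
      using c f F filter_mem_carrier upI by metis
  qed
  show "translate (translate F s) (s\<^sup>\<star>) \<subseteq> F"
  proof
    fix y assume y: "y \<in> translate (translate F s) (s\<^sup>\<star>)"
    then obtain x where x: "x \<in> translate F s" "x \<cdot> s\<^sup>\<star> \<lesssim> y" and yS: "y \<in> S"
      unfolding translate_def[of "translate F s"] by (auto elim!: upE set_multE)
    from x(1) obtain f where f: "f \<in> F" "f \<cdot> s \<lesssim> x" and xS: "x \<in> S"
      unfolding translate_def by (auto elim!: upE set_multE)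
    obtain c where c: "c \<in> F" "c \<lesssim> f" "c \<cdot> s \<cdot> s\<^sup>\<star> = c"
      using translatable_directed assms f by metis
    have S: "f \<in> S" "c \<in> S"
      using c f F filter_mem_carrier by auto
    have "c \<cdot> s \<lesssim> x"
      using below_trans[OF _ _ _ below_mult_right f(2)] S s c xS carrier by blast
    then have "c \<cdot> s \<cdot> s\<^sup>\<star> \<lesssim> x \<cdot> s\<^sup>\<star>"
      using S s c xS by (intro below_mult_right) (simp_all add: carrier star_star)
    then have "c \<lesssim> y"
      using c(3) below_trans[OF _ _ _ _ x(2)] S s xS yS carrier by simp
    then show "y \<in> F"
      using filter_upward[OF F c(1)] yS by blast
  qed
qed

text \<open>
  An ultrafilter is maximal among filters other than \<open>S\<close>, but \<open>S\<close> may itself be a filter (for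
  instance if it has a zero). This lemma ensures that translation does not mix
  the filter \<open>S\<close> with the other ones.
\<close>

lemma translate_carrier:
  assumes "filter_in S" "s \<in> S"
  shows "translate S s = S"
proof
  show "translate S s \<subseteq> S"
    unfolding translate_def by (rule up_carrier)
  show "S \<subseteq> translate S s"
  proof
    fix a assume a: "a \<in> S"
    obtain t where t: "t \<in> S" "t \<lesssim> a" "t \<lesssim> s"
      using filter_directed assms a by metis
    have "t \<cdot> s\<^sup>\<star> \<cdot> s \<in> S \<odot> {s}"
      using t assms by (simp add: set_multI carrier)
    then show "a \<in> translate S s"
      unfolding translate_def using below_eq[OF t(3)] t(2) a upI by metis
  qed
qed

section \<open>Ultrafilters\<close>

lemma ultrafilter_filter: "ultrafilter_in U \<Longrightarrow> filter_in U"
  unfolding ultrafilter_in_def by blast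

lemma ultrafilter_proper: "ultrafilter_in U \<Longrightarrow> U \<noteq> S"
  unfolding ultrafilter_in_def by blast

lemma ultrafilter_maximal:
  "ultrafilter_in U \<Longrightarrow> filter_in V \<Longrightarrow> V \<noteq> S \<Longrightarrow> U \<subseteq> V \<Longrightarrow> V = U"
  unfolding ultrafilter_in_def by blast

lemma ultrafilter_subset_eq: "ultrafilter_in U \<Longrightarrow> ultrafilter_in V \<Longrightarrow> U \<subseteq> V \<Longrightarrow> V = U"
  by (simp add: ultrafilter_maximal ultrafilter_filter ultrafilter_proper)

lemma ultrafilter_coset: "ultrafilter_in U \<Longrightarrow> coset U"
  using ultrafilter_filter filter_coset by blast

lemma ultrafilter_star:
  assumes U: "ultrafilter_in U"
  shows "ultrafilter_in (U\<^sup>\<circledast>)"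
proof -
  note f = ultrafilter_filter[OF U]
  have SS: "S\<^sup>\<circledast> = S"
    using set_star_carrier[of S] set_star_star[of S] unfolding set_star_def by blast
  have flip: "V = W\<^sup>\<circledast>" if "V \<subseteq> S" "V\<^sup>\<circledast> = W" for V W
    using set_star_star[OF that(1)] that(2) by simp
  show ?thesis
    unfolding ultrafilter_in_def
  proof (intro conjI allI impI)
    show "filter_in (U\<^sup>\<circledast>)"
      using filter_star f .
    show "U\<^sup>\<circledast> \<noteq> S"
      using flip[OF filter_carrier[OF f], of S] SS ultrafilter_proper[OF U] by auto
    fix V assume V: "filter_in V \<and> V \<noteq> S \<and> U\<^sup>\<circledast> \<subseteq> V"
    have "V\<^sup>\<circledast> = U"
    proof (rule ultrafilter_maximal[OF U])
      show "filter_in (V\<^sup>\<circledast>)"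
        using filter_star V by blast
      show "V\<^sup>\<circledast> \<noteq> S"
        using flip[of V S] filter_carrier V SS by auto
      have "(U\<^sup>\<circledast>)\<^sup>\<circledast> \<subseteq> V\<^sup>\<circledast>"
        using V unfolding set_star_def by blast
      then show "U \<subseteq> V\<^sup>\<circledast>"
        using set_star_star[OF filter_carrier[OF f]] by simp
    qed
    then show "V = U\<^sup>\<circledast>"
      using flip filter_carrier V by blast
  qed
qed

text \<open>
  A filter \<open>V\<close> above the translate can be translated back by \<open>s\<^sup>\<star>\<close>, to a filter above \<open>U\<close>, which
  equals \<open>U\<close> by maximality.
\<close>

lemma ultrafilter_translate:
  assumes U: "ultrafilter_in U" and s: "translatable U s"
  shows "ultrafilter_in (translate U s)"
  unfolding ultrafilter_in_def
proof (intro conjI allI impI)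
  have sS: "s \<in> S"
    using s unfolding translatable_def by blast
  show "filter_in (translate U s)"
    using filter_translate s .
  then show "translate U s \<noteq> S"
    using translate_carrier[of "s\<^sup>\<star>"] translate_translate[OF s] ultrafilter_proper[OF U] sS star_closed
    by auto
  fix V assume "filter_in V \<and> V \<noteq> S \<and> translate U s \<subseteq> V"
  then have V: "filter_in V" "V \<noteq> S" "translate U s \<subseteq> V"
    by blast+
  have Vs: "translatable V (s\<^sup>\<star>)"
    using translatable_mono[OF translatable_translate[OF s] V(3,1)] .
  have VV: "translate (translate V (s\<^sup>\<star>)) s = V"
    using translate_translate[OF Vs] sS by (simp add: star_star)
  have "translate V (s\<^sup>\<star>) = U"
  proof (rule ultrafilter_maximal[OF U])
    show "filter_in (translate V (s\<^sup>\<star>))"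
      using filter_translate[OF Vs] .
    then show "translate V (s\<^sup>\<star>) \<noteq> S"
      using translate_carrier[OF _ sS] VV V(2) by auto
    show "U \<subseteq> translate V (s\<^sup>\<star>)"
      using translate_mono[OF V(3), of "s\<^sup>\<star>"] translate_translate[OF s] by simp
  qed
  then show "V = translate U s"
    using VV by simp
qed

text \<open>
  The set \<open>B\<^sup>\<star> B\<close> contains an element \<open>x\<^sup>\<star> y\<close> below some \<open>d d\<^sup>\<star>\<close> with \<open>d \<lesssim> c\<close>, on which \<open>c c\<^sup>\<star>\<close> acts as
  a right identity; the triple product \<open>x x\<^sup>\<star> y\<close> carries this property into \<open>B\<close>.
\<close>

lemma translatable_of_source:
  assumes B: "filter_in B" and C: "filter_in C" and BC: "source B = range_of C" and c: "c \<in> C"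
  shows "translatable B c"
proof -
  obtain d where d: "d \<in> C" "d \<lesssim> c"
    using filter_directed C c by metis
  note cd = filter_mem_carrier[OF C d(1)] filter_mem_carrier[OF C c]
  have "d \<cdot> d\<^sup>\<star> \<in> C \<odot> C\<^sup>\<circledast>"
    using d by (simp add: set_multI set_starI)
  then have "d \<cdot> d\<^sup>\<star> \<in> source B"
    using C BC rounded_subset_up[of "C \<odot> C\<^sup>\<circledast>"]
    unfolding range_of_def by (auto simp: rounded_mult rounded_star filter_rounded)
  then obtain x y where xy: "x \<in> B" "y \<in> B" and below: "x\<^sup>\<star> \<cdot> y \<lesssim> d \<cdot> d\<^sup>\<star>"
    unfolding source_def set_mult_def set_star_def by (auto elim!: upE)
  note xyS = xy[THEN filter_mem_carrier[OF B]]
  have dc: "d\<^sup>\<star> \<cdot> c \<cdot> c\<^sup>\<star> = d\<^sup>\<star>"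
    using below_eq[OF below_star[OF cd d(2)]] cd by (simp add: star_star)
  have "(d \<cdot> d\<^sup>\<star>) \<cdot> c \<cdot> c\<^sup>\<star> = d \<cdot> (d\<^sup>\<star> \<cdot> c \<cdot> c\<^sup>\<star>)"
    using cd by (simp add: normalize)
  then have "(x\<^sup>\<star> \<cdot> y) \<cdot> c \<cdot> c\<^sup>\<star> = x\<^sup>\<star> \<cdot> y"
    using below_fix_right[OF _ _ _ below] xyS cd dc by (simp add: carrier)
  then have "(x \<cdot> x\<^sup>\<star> \<cdot> y) \<cdot> c \<cdot> c\<^sup>\<star> = x \<cdot> x\<^sup>\<star> \<cdot> y"
    using xyS cd by (simp add: normalize)
  then show ?thesis
    unfolding translatable_def
    using coset_triple[OF filter_coset[OF B]] xy B cd by blast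
qed

text \<open>
  The product contains the ultrafilter \<open>translate B c\<close>, so it suffices that it is a proper filter. If
  it were \<open>S\<close>, multiplying by \<open>C\<^sup>\<star>\<close> would give \<open>B = S\<close>.
\<close>

lemma ultrafilter_mult:
  assumes B: "ultrafilter_in B" and C: "ultrafilter_in C" and BC: "source B = range_of C"
  shows "ultrafilter_in (up (B \<odot> C))"
proof -
  note fB = ultrafilter_filter[OF B] and fC = ultrafilter_filter[OF C]
  note cB = filter_coset[OF fB] and cC = filter_coset[OF fC]
  obtain c where c: "c \<in> C"
    using filter_nonempty[OF fC] by blast
  have cS: "c \<in> S"
    using filter_mem_carrier[OF fC c] .
  have ultra: "ultrafilter_in (translate B c)"
    using ultrafilter_translate[OF B translatable_of_source[OF fB fC BC c]] .
  have sub: "translate B c \<subseteq> up (B \<odot> C)"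
    unfolding translate_def using c by (simp add: up_mono set_mult_mono)
  have filt: "filter_in (up (B \<odot> C))"
    using filter_mult fB fC .
  have "up (B \<odot> C) \<noteq> S"
  proof
    assume S: "up (B \<odot> C) = S"
    have "S = translate S (c\<^sup>\<star>)"
      using translate_carrier[of "c\<^sup>\<star>"] S filt cS star_closed by simp
    also have "\<dots> \<subseteq> up (up (B \<odot> C) \<odot> C\<^sup>\<circledast>)"
      unfolding translate_def S using c by (simp add: up_mono set_mult_mono set_starI)
    also have "\<dots> = B"
      using up_mult_inverse[OF cB cC BC] .
    finally show False
      using ultrafilter_proper[OF B] filter_carrier[OF fB] by blast
  qed
  then have "up (B \<odot> C) = translate B c"
    using ultrafilter_maximal[OF ultra filt] sub by blast
  then show ?thesis
    using ultra by simp
qed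

lemma mem_ultrafilters: "U \<in> ultrafilters \<longleftrightarrow> ultrafilter_in U"
  unfolding ultrafilters_def by simp

lemma ultrafilters_subset_cosets: "ultrafilters \<subseteq> cosets"
  using ultrafilter_coset ultrafilter_filter filter_nonempty
  by (auto simp: mem_ultrafilters mem_cosets)

lemma subgroupoid_ultrafilters: "subgroupoid ultrafilters coset_groupoid"
  unfolding subgroupoid_def
  using groupoid_coset_groupoid ultrafilters_subset_cosets
  by (auto simp: mem_ultrafilters ultrafilter_star ultrafilter_mult composable_coset_groupoid)

section \<open>The topology of the Weyl groupoid\<close>

lemma weyl_groupoid_simps [simp]:
  "arrows weyl_groupoid = ultrafilters"
  "gcomp weyl_groupoid = (\<lambda>B C. up (B \<odot> C))"
  "ginv weyl_groupoid = set_star"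
  unfolding weyl_groupoid_def restrict_groupoid_def using ultrafilters_subset_cosets by auto

lemma composable_weyl_groupoid:
  "(B, C) \<in> composable weyl_groupoid \<longleftrightarrow> ultrafilter_in B \<and> ultrafilter_in C \<and> source B = range_of C"
  unfolding weyl_groupoid_def restrict_groupoid_def
  using ultrafilters_subset_cosets by (auto simp: composable_coset_groupoid mem_ultrafilters)

definition basic_open :: "'a \<Rightarrow> 'a set set" where
  "basic_open a = {U \<in> ultrafilters. a \<in> U}"

lemma mem_basic_open: "U \<in> basic_open a \<longleftrightarrow> ultrafilter_in U \<and> a \<in> U"
  unfolding basic_open_def by (simp add: mem_ultrafilters)

text \<open>
  Filters are downward directed, so the subbasic sets already form a basis of the restricted
  topology.
\<close>

lemma openin_weyl_iff:
  "openin weyl_topology W \<longleftrightarrow>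
     W \<subseteq> ultrafilters \<and> (\<forall>U\<in>W. \<exists>a\<in>U. basic_open a \<subseteq> W)"
proof
  assume "openin weyl_topology W"
  then obtain X where X: "openin coset_topology X" "W = X \<inter> ultrafilters"
    unfolding weyl_topology_def openin_subtopology by blast
  from X(1) have "generate_topology_on {{C \<in> cosets. a \<in> C} | a. a \<in> S} X"
    unfolding coset_topology_def openin_topology_generated_by_iff .
  then have "\<exists>a\<in>U. basic_open a \<subseteq> X" if "U \<in> X" "ultrafilter_in U" for U
    using that
  proof (induction arbitrary: U)
    case Empty
    then show ?case by simp
  next
    case (Int X Y)
    note F = ultrafilter_filter[OF Int.prems(2)]
    obtain a where a: "a \<in> U" "basic_open a \<subseteq> X"
      using Int.IH(1)[of U] Int.prems by blast
    obtain b where b: "b \<in> U" "basic_open b \<subseteq> Y"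
      using Int.IH(2)[of U] Int.prems by blast
    obtain c where c: "c \<in> U" "c \<lesssim> a" "c \<lesssim> b"
      using filter_directed F a b by metis
    have "V \<in> basic_open a \<and> V \<in> basic_open b" if "V \<in> basic_open c" for V
      using filter_upward[of V c] that c(2,3) a(1) b(1) filter_mem_carrier[OF F]
      by (simp add: mem_basic_open ultrafilter_filter)
    then show ?case
      using a b c(1) by blast
  next
    case (UN K)
    then obtain X where "X \<in> K" "U \<in> X"
      by blast
    then obtain a where "a \<in> U" "basic_open a \<subseteq> X"
      using UN.IH UN.prems(2) by metis
    then show ?case
      using \<open>X \<in> K\<close> by blast
  next
    case (Basis B)
    then obtain a where "B = {C \<in> cosets. a \<in> C}"
      by blast
    then show ?case
      using Basis.prems(1) ultrafilters_subset_cosets unfolding basic_open_def by blast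
  qed
  note X_nbhd = this
  have "\<exists>a\<in>U. basic_open a \<subseteq> W" if "U \<in> W" for U
  proof -
    obtain a where "a \<in> U" "basic_open a \<subseteq> X"
      using X_nbhd[of U] \<open>U \<in> W\<close> X(2) by (auto simp: mem_ultrafilters)
    then show ?thesis
      using X(2) unfolding basic_open_def by blast
  qed
  then show "W \<subseteq> ultrafilters \<and> (\<forall>U\<in>W. \<exists>a\<in>U. basic_open a \<subseteq> W)"
    using X(2) by simp
next
  assume W: "W \<subseteq> ultrafilters \<and> (\<forall>U\<in>W. \<exists>a\<in>U. basic_open a \<subseteq> W)"
  have "openin weyl_topology (basic_open a)" if "a \<in> S" for a
  proof -
    have "openin coset_topology {C \<in> cosets. a \<in> C}"
      unfolding coset_topology_def using that by (intro topology_generated_by_Basis) blast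
    then have "openin weyl_topology ({C \<in> cosets. a \<in> C} \<inter> ultrafilters)"
      unfolding weyl_topology_def openin_subtopology by blast
    moreover have "{C \<in> cosets. a \<in> C} \<inter> ultrafilters = basic_open a"
      using ultrafilters_subset_cosets unfolding basic_open_def by blast
    ultimately show ?thesis
      by simp
  qed
  note basic = this
  show "openin weyl_topology W"
  proof (subst openin_subopen, intro ballI)
    fix U assume U: "U \<in> W"
    then obtain a where a: "a \<in> U" "basic_open a \<subseteq> W"
      using W by blast
    have "ultrafilter_in U"
      using U W mem_ultrafilters by blast
    then have "openin weyl_topology (basic_open a)" "U \<in> basic_open a"
      using basic filter_mem_carrier[OF ultrafilter_filter] a(1) by (simp_all add: mem_basic_open)
    then show "\<exists>T. openin weyl_topology T \<and> U \<in> T \<and> T \<subseteq> W"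
      using a(2) by blast
  qed
qed

lemma openin_weylI:
  assumes "W \<subseteq> ultrafilters" "\<And>U. U \<in> W \<Longrightarrow> \<exists>a\<in>U. basic_open a \<subseteq> W"
  shows "openin weyl_topology W"
  unfolding openin_weyl_iff using assms by simp

lemma openin_weylE:
  assumes "openin weyl_topology W" "U \<in> W"
  obtains a where "a \<in> U" "basic_open a \<subseteq> W"
  using assms unfolding openin_weyl_iff by metis

lemma openin_weyl_basic: "openin weyl_topology (basic_open a)"
  by (rule openin_weylI) (auto simp: mem_basic_open mem_ultrafilters)

lemma topspace_weyl: "topspace weyl_topology = ultrafilters"
proof (rule antisym)
  show "topspace weyl_topology \<subseteq> ultrafilters"
    unfolding weyl_topology_def by simp
  have "openin weyl_topology ultrafilters"
  proof (rule openin_weylI)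
    fix U assume "U \<in> ultrafilters"
    then obtain a where "a \<in> U"
      using ultrafilter_filter filter_nonempty mem_ultrafilters by blast
    then show "\<exists>a\<in>U. basic_open a \<subseteq> ultrafilters"
      unfolding basic_open_def by blast
  qed simp
  then show "ultrafilters \<subseteq> topspace weyl_topology"
    by (rule openin_subset)
qed

lemma continuous_inverse: "continuous_map weyl_topology weyl_topology set_star"
  unfolding continuous_map topspace_weyl
proof (intro conjI allI impI)
  show "set_star ` ultrafilters \<subseteq> ultrafilters"
    by (auto simp: mem_ultrafilters ultrafilter_star)
  fix W assume W: "openin weyl_topology W"
  show "openin weyl_topology {U \<in> ultrafilters. U\<^sup>\<circledast> \<in> W}"
  proof (rule openin_weylI)
    fix U assume "U \<in> {U \<in> ultrafilters. U\<^sup>\<circledast> \<in> W}"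
    then have "U\<^sup>\<circledast> \<in> W"
      by simp
    then obtain x where x: "x \<in> U\<^sup>\<circledast>" "basic_open x \<subseteq> W"
      using openin_weylE W by metis
    then obtain a where a: "a \<in> U" "x = a\<^sup>\<star>"
      unfolding set_star_def by blast
    have "basic_open a \<subseteq> {U \<in> ultrafilters. U\<^sup>\<circledast> \<in> W}"
    proof
      fix V assume "V \<in> basic_open a"
      then have "V\<^sup>\<circledast> \<in> basic_open x" "V \<in> ultrafilters"
        using a(2) by (simp_all add: mem_basic_open ultrafilter_star set_starI mem_ultrafilters)
      then show "V \<in> {U \<in> ultrafilters. U\<^sup>\<circledast> \<in> W}"
        using x(2) by blast
    qed
    then show "\<exists>a\<in>U. basic_open a \<subseteq> {U \<in> ultrafilters. U\<^sup>\<circledast> \<in> W}"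
      using a(1) by blast
  qed simp
qed

abbreviation "composable_weyl \<equiv> composable_topology weyl_groupoid weyl_topology"

lemma topspace_composable_weyl: "topspace composable_weyl = composable weyl_groupoid"
  unfolding composable_topology_def
  by (auto simp: topspace_weyl composable_weyl_groupoid mem_ultrafilters)

lemma continuous_product:
  "continuous_map composable_weyl weyl_topology (\<lambda>(B, C). up (B \<odot> C))"
  unfolding continuous_map topspace_composable_weyl
proof (intro conjI allI impI)
  show "(\<lambda>(B, C). up (B \<odot> C)) ` composable weyl_groupoid \<subseteq> topspace weyl_topology"
    by (auto simp: composable_weyl_groupoid ultrafilter_mult topspace_weyl mem_ultrafilters)
  fix W assume W: "openin weyl_topology W"
  let ?P = "{p \<in> composable weyl_groupoid. (case p of (B, C) \<Rightarrow> up (B \<odot> C)) \<in> W}"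
  show "openin composable_weyl ?P"
  proof (subst openin_subopen, intro ballI)
    fix p assume "p \<in> ?P"
    then obtain B C where p: "p = (B, C)" "(B, C) \<in> composable weyl_groupoid" "up (B \<odot> C) \<in> W"
      by (cases p) auto
    then obtain a where a: "a \<in> up (B \<odot> C)" "basic_open a \<subseteq> W"
      using openin_weylE W by metis
    then obtain b c where bc: "b \<in> B" "c \<in> C" "b \<cdot> c \<lesssim> a" "a \<in> S"
      by (auto elim!: upE set_multE)
    let ?Q = "(basic_open b \<times> basic_open c) \<inter> composable weyl_groupoid"
    have "openin composable_weyl ?Q"
      unfolding composable_topology_def
      by (intro openin_subtopology_Int) (simp add: openin_prod_Times_iff openin_weyl_basic)
    moreover have "p \<in> ?Q"
      using p(1,2) bc(1,2) by (simp add: composable_weyl_groupoid mem_basic_open)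
    moreover have "?Q \<subseteq> ?P"
    proof
      fix q assume q: "q \<in> ?Q"
      then obtain B' C' where q': "q = (B', C')" "b \<in> B'" "c \<in> C'"
        by (auto simp: mem_basic_open)
      have comp: "(B', C') \<in> composable weyl_groupoid"
        using q q'(1) by blast
      have "a \<in> up (B' \<odot> C')"
        using upI[OF set_multI] q'(2,3) bc(3,4) by blast
      then have "up (B' \<odot> C') \<in> basic_open a"
        using comp by (simp add: composable_weyl_groupoid ultrafilter_mult mem_basic_open)
      then show "q \<in> ?P"
        using a(2) comp q'(1) by auto
    qed
    ultimately show "\<exists>T. openin composable_weyl T \<and> p \<in> T \<and> T \<subseteq> ?P"
      by blast
  qed
qed

text \<open>
  A source \<open>V\<^sup>\<star> V\<close> contains \<open>v\<^sup>\<star> v \<in> E\<close>. Conversely, if \<open>U\<close> meets \<open>E\<close>, then below every \<open>t \<in> U\<close> there is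
  \<open>x \<in> U \<inter> E\<close>, as \<open>E\<close> is closed downwards; since \<open>x\<^sup>\<star> \<in> E\<close>, even \<open>x\<^sup>\<star> x \<lesssim> t\<close>. Hence \<open>U\<close> is contained in its own
  source, and equals it by maximality.
\<close>

lemma ultrafilter_unit_iff:
  "U \<in> units weyl_groupoid \<longleftrightarrow> U \<in> ultrafilters \<and> U \<inter> E \<noteq> {}"
proof
  assume "U \<in> units weyl_groupoid"
  then obtain V where V: "ultrafilter_in V" and UV: "U = up (V\<^sup>\<circledast> \<odot> V)"
    unfolding units_def by (auto simp: mem_ultrafilters)
  note f = ultrafilter_filter[OF V]
  note c = filter_coset[OF f]
  obtain v where v: "v \<in> V"
    using filter_nonempty[OF f] by blast
  have "v\<^sup>\<star> \<cdot> v \<in> V\<^sup>\<circledast> \<odot> V"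
    using v by (simp add: set_multI set_starI)
  moreover have "rounded (V\<^sup>\<circledast> \<odot> V)"
    using f by (simp add: rounded_mult rounded_star filter_rounded)
  ultimately have "v\<^sup>\<star> \<cdot> v \<in> U"
    using UV rounded_subset_up by blast
  then have "U \<inter> E \<noteq> {}"
    using star_mult_self filter_mem_carrier[OF f v] by blast
  moreover have "ultrafilter_in U"
    unfolding UV using V c by (intro ultrafilter_mult) (simp_all add: ultrafilter_star source_star)
  ultimately show "U \<in> ultrafilters \<and> U \<inter> E \<noteq> {}"
    by (simp add: mem_ultrafilters)
next
  assume "U \<in> ultrafilters \<and> U \<inter> E \<noteq> {}"
  then obtain e where U: "ultrafilter_in U" and e: "e \<in> U" "e \<in> E"
    by (auto simp: mem_ultrafilters)
  note f = ultrafilter_filter[OF U]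
  note c = filter_coset[OF f]
  have "ultrafilter_in (up (U\<^sup>\<circledast> \<odot> U))"
    using U c by (intro ultrafilter_mult) (simp_all add: ultrafilter_star source_star)
  moreover have "U \<subseteq> up (U\<^sup>\<circledast> \<odot> U)"
  proof
    fix t assume t: "t \<in> U"
    obtain x where x: "x \<in> U" "x \<lesssim> t" "x \<lesssim> e"
      using filter_directed f t e by metis
    have S: "t \<in> S" "x \<in> S"
      using filter_mem_carrier f t x by auto
    have xE: "x \<in> E"
      using below_E_down x(3) e(2) by blast
    have eq: "(x\<^sup>\<star> \<cdot> x) \<cdot> t\<^sup>\<star> = x\<^sup>\<star> \<cdot> (x \<cdot> t\<^sup>\<star>)"
      using S by (simp add: normalize)
    have "x\<^sup>\<star> \<cdot> x \<lesssim> t"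
    proof (rule belowI)
      show "(x\<^sup>\<star> \<cdot> x) \<cdot> t\<^sup>\<star> \<in> E"
        unfolding eq using E_mult_closed E_star_closed xE below_E[OF x(2)] by blast
      have "(x\<^sup>\<star> \<cdot> x) \<cdot> t\<^sup>\<star> \<cdot> t = x\<^sup>\<star> \<cdot> (x \<cdot> t\<^sup>\<star> \<cdot> t)"
        using S by (simp add: normalize)
      then show "(x\<^sup>\<star> \<cdot> x) \<cdot> t\<^sup>\<star> \<cdot> t = x\<^sup>\<star> \<cdot> x"
        using below_eq[OF x(2)] by simp
    qed
    then show "t \<in> up (U\<^sup>\<circledast> \<odot> U)"
      using upI[OF set_multI[OF set_starI]] x(1) S(1) by blast
  qed
  ultimately have "up (U\<^sup>\<circledast> \<odot> U) = U"
    using ultrafilter_subset_eq[OF U] by simp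
  then show "U \<in> units weyl_groupoid"
    unfolding units_def using U by (auto simp: mem_ultrafilters)
qed

lemma openin_units: "openin weyl_topology (units weyl_groupoid)"
proof (rule openin_weylI)
  show "units weyl_groupoid \<subseteq> ultrafilters"
    by (auto simp: ultrafilter_unit_iff)
  fix U assume "U \<in> units weyl_groupoid"
  then obtain e where e: "e \<in> U" "e \<in> E"
    by (auto simp: ultrafilter_unit_iff)
  then have "basic_open e \<subseteq> units weyl_groupoid"
    by (auto simp: ultrafilter_unit_iff mem_basic_open mem_ultrafilters)
  then show "\<exists>a\<in>U. basic_open a \<subseteq> units weyl_groupoid"
    using e(1) by blast
qed

text \<open>
  This is the local section of the range map through \<open>s\<close>: the range unit of \<open>Q\<close> is translated by \<open>s\<close>. It
  exists as soon as \<open>s s\<^sup>\<star>\<close> fixes one element of \<open>Q\<close> from the left.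
\<close>

lemma ultrafilter_range_through:
  assumes Q: "ultrafilter_in Q" and q: "q \<in> Q" and s: "s \<in> S" and sq: "s \<cdot> s\<^sup>\<star> \<cdot> q = q"
  obtains B where "ultrafilter_in B" "s \<in> B" "range_of B = range_of Q"
proof -
  note f = ultrafilter_filter[OF Q]
  note c = filter_coset[OF f]
  have qS: "q \<in> S"
    using filter_mem_carrier[OF f q] .
  define T where "T = range_of Q"
  have T: "ultrafilter_in T"
    unfolding T_def range_of_def
    using Q c by (intro ultrafilter_mult) (simp_all add: ultrafilter_star range_star)
  note fT = ultrafilter_filter[OF T]
  have eT: "q \<cdot> q\<^sup>\<star> \<in> T"
    unfolding T_def range_of_def
    using rounded_subset_up[of "Q \<odot> Q\<^sup>\<circledast>"] f q
    by (auto simp: rounded_mult rounded_star filter_rounded set_multI set_starI)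
  have "q\<^sup>\<star> \<cdot> s \<cdot> s\<^sup>\<star> = (s \<cdot> s\<^sup>\<star> \<cdot> q)\<^sup>\<star>"
    using qS s by (simp add: normalize)
  then have "q \<cdot> (q\<^sup>\<star> \<cdot> s \<cdot> s\<^sup>\<star>) = q \<cdot> q\<^sup>\<star>"
    using sq by simp
  then have es: "(q \<cdot> q\<^sup>\<star>) \<cdot> s \<cdot> s\<^sup>\<star> = q \<cdot> q\<^sup>\<star>"
    using qS s by (simp add: normalize)
  have tr: "translatable T s"
    unfolding translatable_def using fT s eT es by blast
  define B where "B = translate T s"
  have B: "ultrafilter_in B"
    unfolding B_def using ultrafilter_translate[OF T tr] .
  have below: "(q \<cdot> q\<^sup>\<star>) \<cdot> s \<lesssim> s"
  proof (rule belowI)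
    show "(q \<cdot> q\<^sup>\<star>) \<cdot> s \<cdot> s\<^sup>\<star> \<in> E"
      using es mult_star_self[OF qS] by simp
    show "(q \<cdot> q\<^sup>\<star>) \<cdot> s \<cdot> s\<^sup>\<star> \<cdot> s = (q \<cdot> q\<^sup>\<star>) \<cdot> s"
      using es by simp
  qed
  have sB: "s \<in> B"
    using filter_upward[OF ultrafilter_filter[OF B] _ below s] translate_memI[OF tr eT es]
    unfolding B_def by blast
  have "T = translate B (s\<^sup>\<star>)"
    unfolding B_def using translate_translate[OF tr] by simp
  also have "\<dots> \<subseteq> range_of B"
    unfolding translate_def range_of_def using sB by (simp add: up_mono set_mult_mono set_starI)
  finally have "T \<subseteq> range_of B" .
  moreover have "ultrafilter_in (range_of B)"
    unfolding range_of_def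
    using B ultrafilter_coset[OF B] by (intro ultrafilter_mult) (simp_all add: ultrafilter_star range_star)
  ultimately have "range_of B = T"
    using ultrafilter_subset_eq[OF T] by simp
  then show thesis
    using that B sB unfolding T_def by blast
qed

text \<open>
  The factors are \<open>B\<close>, the value at \<open>Q\<close> of the local section through \<open>b\<close>, and \<open>C = B\<^sup>-\<^sup>1 Q\<close>. The gaps
  \<open>b' \<lesssim> b\<close> and \<open>c' \<lesssim> c\<close> are what make \<open>b\<^sup>\<star> b' c'\<close>, an element of \<open>B\<^sup>\<star> Q\<close>, lie below \<open>c\<close>.
\<close>

lemma factor_through:
  assumes Q: "ultrafilter_in Q" and S: "b \<in> S" "b' \<in> S" "c \<in> S" "c' \<in> S"
    and b: "b' \<lesssim> b" and c: "c' \<lesssim> c" and bc: "b' \<cdot> c' \<in> Q"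
  obtains B C where "(B, C) \<in> composable weyl_groupoid" "b \<in> B" "c \<in> C" "Q = up (B \<odot> C)"
proof -
  have "b \<cdot> b\<^sup>\<star> \<cdot> (b' \<cdot> c') = (b \<cdot> b\<^sup>\<star> \<cdot> b') \<cdot> c'"
    using S by (simp add: normalize)
  then have "b \<cdot> b\<^sup>\<star> \<cdot> (b' \<cdot> c') = b' \<cdot> c'"
    using below_left_eq[OF S(2,1) b] by simp
  then obtain B where B: "ultrafilter_in B" "b \<in> B" "range_of B = range_of Q"
    using ultrafilter_range_through[OF Q bc S(1)] by blast
  note cB = ultrafilter_coset[OF B(1)] and cQ = ultrafilter_coset[OF Q]
  have BQ: "source (B\<^sup>\<circledast>) = range_of Q"
    using B(3) cB by (simp add: source_star)
  define C where "C = up (B\<^sup>\<circledast> \<odot> Q)"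
  have C: "ultrafilter_in C"
    unfolding C_def using ultrafilter_mult[OF ultrafilter_star[OF B(1)] Q BQ] .
  have "range_of C = source B"
    unfolding C_def using range_mult[OF coset_star[OF cB] cQ BQ] cB by (simp add: range_star)
  then have comp: "(B, C) \<in> composable weyl_groupoid"
    using B(1) C by (simp add: composable_weyl_groupoid)
  have prod: "Q = up (B \<odot> C)"
    unfolding C_def using up_inverse_mult[OF coset_star[OF cB] cQ BQ] cB
    by (simp add: set_star_star coset_carrier)
  have bb: "b\<^sup>\<star> \<cdot> b' \<in> E"
    using E_star_closed[OF below_left_E[OF S(2,1) b]] S by (simp add: normalize)
  have eq: "(b\<^sup>\<star> \<cdot> (b' \<cdot> c')) \<cdot> c\<^sup>\<star> = (b\<^sup>\<star> \<cdot> b') \<cdot> (c' \<cdot> c\<^sup>\<star>)"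
    using S by (simp add: normalize)
  have "b\<^sup>\<star> \<cdot> (b' \<cdot> c') \<lesssim> c"
  proof (rule belowI)
    show "(b\<^sup>\<star> \<cdot> (b' \<cdot> c')) \<cdot> c\<^sup>\<star> \<in> E"
      unfolding eq using E_mult_closed bb below_E[OF c] by blast
    have "(b\<^sup>\<star> \<cdot> (b' \<cdot> c')) \<cdot> c\<^sup>\<star> \<cdot> c = b\<^sup>\<star> \<cdot> (b' \<cdot> (c' \<cdot> c\<^sup>\<star> \<cdot> c))"
      using S by (simp add: normalize)
    then show "(b\<^sup>\<star> \<cdot> (b' \<cdot> c')) \<cdot> c\<^sup>\<star> \<cdot> c = b\<^sup>\<star> \<cdot> (b' \<cdot> c')"
      using below_eq[OF c] by simp
  qed
  then have "c \<in> C"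
    unfolding C_def using upI[OF set_multI[OF set_starI]] B(2) bc S(3) by blast
  then show thesis
    using that comp B(2) prod by blast
qed

lemma open_product:
  "open_map composable_weyl weyl_topology (\<lambda>(B, C). up (B \<odot> C))"
  unfolding open_map_def
proof (intro allI impI)
  fix W assume "openin composable_weyl W"
  then obtain X where X: "openin (prod_topology weyl_topology weyl_topology) X"
    and W: "W = X \<inter> composable weyl_groupoid"
    unfolding composable_topology_def openin_subtopology by blast
  let ?I = "(\<lambda>(B, C). up (B \<odot> C)) ` W"
  show "openin weyl_topology ?I"
  proof (rule openin_weylI)
    show "?I \<subseteq> ultrafilters"
      unfolding W by (auto simp: composable_weyl_groupoid ultrafilter_mult mem_ultrafilters)
    fix P assume "P \<in> ?I"
    then obtain B C where P: "P = up (B \<odot> C)" and BC: "(B, C) \<in> W"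
      by auto
    have comp: "ultrafilter_in B" "ultrafilter_in C"
      using BC unfolding W by (simp_all add: composable_weyl_groupoid)
    note fB = ultrafilter_filter[OF comp(1)] and fC = ultrafilter_filter[OF comp(2)]
    obtain M N where MN: "openin weyl_topology M" "openin weyl_topology N"
        "B \<in> M" "C \<in> N" "M \<times> N \<subseteq> X"
      using X BC unfolding W openin_prod_topology_alt by (metis IntD1)
    obtain b where b: "b \<in> B" "basic_open b \<subseteq> M"
      using openin_weylE MN(1,3) by metis
    obtain c where c: "c \<in> C" "basic_open c \<subseteq> N"
      using openin_weylE MN(2,4) by metis
    obtain b' where b': "b' \<in> B" "b' \<lesssim> b"
      using filter_directed fB b(1) by metis
    obtain c' where c': "c' \<in> C" "c' \<lesssim> c"
      using filter_directed fC c(1) by metis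
    have S: "b \<in> S" "b' \<in> S" "c \<in> S" "c' \<in> S"
      using filter_mem_carrier fB fC b b' c c' by auto
    have "b' \<cdot> c' \<in> P"
      unfolding P using rounded_subset_up[of "B \<odot> C"] fB fC b'(1) c'(1)
      by (auto simp: rounded_mult filter_rounded set_multI)
    moreover have "basic_open (b' \<cdot> c') \<subseteq> ?I"
    proof
      fix Q assume "Q \<in> basic_open (b' \<cdot> c')"
      then have Q: "ultrafilter_in Q" "b' \<cdot> c' \<in> Q"
        by (simp_all add: mem_basic_open)
      obtain B1 C1 where 1: "(B1, C1) \<in> composable weyl_groupoid" "b \<in> B1" "c \<in> C1"
          "Q = up (B1 \<odot> C1)"
        using factor_through[OF Q(1) S b'(2) c'(2) Q(2)] by blast
      have "B1 \<in> M" "C1 \<in> N"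
        using 1(1-3) b(2) c(2) by (auto simp: composable_weyl_groupoid mem_basic_open subset_iff)
      then have "(B1, C1) \<in> W"
        unfolding W using MN(5) 1(1) by blast
      then show "Q \<in> ?I"
        using 1(4) by (force intro!: image_eqI)
    qed
    ultimately show "\<exists>a\<in>P. basic_open a \<subseteq> ?I"
      by blast
  qed
qed

lemma etale_weyl_groupoid: "etale_groupoid weyl_groupoid weyl_topology"
  unfolding etale_groupoid_def topological_groupoid_def
proof (intro conjI)
  show "groupoid weyl_groupoid"
    unfolding weyl_groupoid_def
    using groupoid_restrict_subgroupoid[OF subgroupoid_ultrafilters] .
qed (simp_all add: topspace_weyl continuous_inverse continuous_product open_product openin_units)

end

theorem theorem2p44:
  fixes S E :: "'a set" and mult :: "'a \<Rightarrow> 'a \<Rightarrow> 'a" and star :: "'a \<Rightarrow> 'a"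
  assumes "weyl_star_semigroup S mult star E"
  shows "subgroupoid (weyl_star_semigroup.ultrafilters S mult star E)
           (weyl_star_semigroup.coset_groupoid S mult star E) \<and>
         etale_groupoid (weyl_star_semigroup.weyl_groupoid S mult star E)
           (weyl_star_semigroup.weyl_topology S mult star E)"
proof -
  interpret weyl_star_semigroup S mult star E
    by (rule assms)
  show ?thesis
    using subgroupoid_ultrafilters etale_weyl_groupoid by blast
qed

end
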